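(* Let $n\in\mathbb{N}_0$, $\alpha>0$, and let $\mu$ be a positive Borel measure on $\mathbb{C}^+$ which is a sampling measure for the wavelet transform with wavelet $\psi_n^\alpha$, with sampling constants $A,B>0$, i.e. $$A\|f\|_{\mathcal{H}^2}^2\le\int_{\mathbb{C}^+}|W_{\psi_n^\alpha}f(z)|^2\,d\mu(z)\le B\|f\|_{\mathcal{H}^2}^2\quad\text{for all } f\in\mathcal{H}^2(\mathbb{C}^+).$$ If $R\in(0,1)$ and there exists $z\in\mathbb{C}^+$ such that $\mu(\mathcal{D}_R(z))=0$, then $$R\le 1-\left(\frac{C_{n,\alpha}}{\pi}\,\frac{A}{B}\right)^{1/\alpha},\qquad\text{where } C_{n,\alpha}=\begin{cases}4^{-(\alpha+1)}, & n=0,\\ 6^{-(2n+\alpha+1)}, & n\in\mathbb{N}.\end{cases}$$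
   Context: $\mathbb{C}^+=\{x+is: x\in\mathbb{R}, s>0\}$ is the upper half-plane. $\mathcal{H}^2(\mathbb{C}^+)$ is the Hardy space of analytic functions $f$ on $\mathbb{C}^+$ with $\|f\|_{\mathcal{H}^2}^2=\sup_{s>0}\int_{\mathbb{R}}|f(x+is)|^2dx<\infty$ (identified with functions on $\mathbb{R}$ via boundary values, whose Fourier transforms are supported on $(0,\infty)$). For $z=x+is\in\mathbb{C}^+$ and $\psi\in\mathcal{H}^2(\mathbb{C}^+)$, the time-scale shift is $\pi(z)\psi(t)=s^{-1/2}\psi(s^{-1}(t-x))$, and the wavelet transform is $W_\psi f(z)=\langle f,\pi(z)\psi\rangle$. For $\alpha>0$ and $n\in\mathbb{N}_0$ the wavelet $\psi_n^\alpha\in\mathcal{H}^2(\mathbb{C}^+)$ is defined via its Fourier transform by $\widehat{\psi_n^\alpha}(t)=\sqrt{\frac{2^{\alpha+2}\pi\, n!}{\Gamma(n+\alpha+1)}}\,t^{\alpha/2}e^{-t}L_n^\alpha(2t)$ for $t>0$ (and $0$ for $t\le 0$), where $L_n^\alpha(t)=\sum_{k=0}^n\frac{(-1)^k}{k!}\binom{n+\alpha}{n-k}t^k$ is the generalized Laguerre polynomial. The pseudohyperbolic metric is $\rho(z,w)=\left|\frac{z-w}{z-\overline{w}}\right|$ for $z,w\in\mathbb{C}^+$, and $\mathcal{D}_R(z)=\{w\in\mathbb{C}^+:\rho(z,w)<R\}$ is the pseudohyperbolic disk. *)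

theory Defs
  imports "HOL-Analysis.Analysis"
begin

definition upper_half :: "complex set" where
  "upper_half = {z. 0 < Im z}"

definition hardy2_sup :: "(complex \<Rightarrow> complex) \<Rightarrow> ennreal" where
  "hardy2_sup f = (SUP s\<in>{0::real<..}.
      \<integral>\<^sup>+ t. ennreal ((cmod (f (complex_of_real t + \<i> * complex_of_real s)))\<^sup>2) \<partial>lborel)"

definition hardy2 :: "(complex \<Rightarrow> complex) \<Rightarrow> bool" where
  "hardy2 f \<longleftrightarrow> f holomorphic_on upper_half \<and> hardy2_sup f < \<infinity>"

definition hardy2_norm_sq :: "(complex \<Rightarrow> complex) \<Rightarrow> real" where
  "hardy2_norm_sq f = enn2real (hardy2_sup f)"

text \<open>Inner product in H^2 (inner product of the boundary values on the real line,
  obtained as the limit of the inner products on horizontal lines).\<close>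
definition hardy2_inner :: "(complex \<Rightarrow> complex) \<Rightarrow> (complex \<Rightarrow> complex) \<Rightarrow> complex" where
  "hardy2_inner f g = Lim (at_right (0::real))
     (\<lambda>s. LINT t|lborel. f (complex_of_real t + \<i> * complex_of_real s)
                         * cnj (g (complex_of_real t + \<i> * complex_of_real s)))"

text \<open>Time-scale shift pi(z), acting on (the analytic extension of) psi.\<close>
definition time_scale_shift :: "complex \<Rightarrow> (complex \<Rightarrow> complex) \<Rightarrow> complex \<Rightarrow> complex" where
  "time_scale_shift z \<psi> = (\<lambda>w. complex_of_real (Im z powr (-1/2))
       * \<psi> ((w - complex_of_real (Re z)) / complex_of_real (Im z)))"

definition wavelet_transform :: "(complex \<Rightarrow> complex) \<Rightarrow> (complex \<Rightarrow> complex) \<Rightarrow> complex \<Rightarrow> complex" where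
  "wavelet_transform \<psi> f z = hardy2_inner f (time_scale_shift z \<psi>)"

definition laguerre :: "nat \<Rightarrow> real \<Rightarrow> real \<Rightarrow> real" where
  "laguerre n \<alpha> t = (\<Sum>k=0..n. (-1)^k / fact k * ((real n + \<alpha>) gchoose (n - k)) * t ^ k)"

definition psi_hat :: "nat \<Rightarrow> real \<Rightarrow> real \<Rightarrow> real" where
  "psi_hat n \<alpha> t = (if 0 < t then
      sqrt (2 powr (\<alpha> + 2) * pi * fact n / Gamma (real n + \<alpha> + 1))
        * t powr (\<alpha> / 2) * exp (- t) * laguerre n \<alpha> (2 * t)
    else 0)"

text \<open>The wavelet psi_n^alpha in H^2, as an analytic function on the upper half-plane,
  obtained by inverse Fourier transform (convention hat f(xi) = int f(t) e^(-i t xi) dt).\<close>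
definition psi :: "nat \<Rightarrow> real \<Rightarrow> complex \<Rightarrow> complex" where
  "psi n \<alpha> w = complex_of_real (1 / (2 * pi))
     * (LINT \<xi>:{0<..}|lborel. complex_of_real (psi_hat n \<alpha> \<xi>) * exp (\<i> * w * complex_of_real \<xi>))"

definition ph_disk :: "real \<Rightarrow> complex \<Rightarrow> complex set" where
  "ph_disk R z = {w \<in> upper_half. cmod ((z - w) / (z - cnj w)) < R}"

definition C_const :: "nat \<Rightarrow> real \<Rightarrow> real" where
  "C_const n \<alpha> = (if n = 0 then 4 powr (-(\<alpha> + 1)) else 6 powr (-(2 * real n + \<alpha> + 1)))"

end

theory Submission
  imports Defs "HOL-Complex_Analysis.Conformal_Mappings"
begin

text \<open>
  The test functions are the shifts \<open>\<pi>(w) \<psi>\<^sub>0\<close>, all of the same norm. By the Laplace transform of the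
  Laguerre polynomials, the squared modulus of the wavelet transform of \<open>\<pi>(w) \<psi>\<^sub>0\<close> with wavelet
  \<open>\<psi>\<^sub>n\<close> at \<open>z\<close> is a constant times \<open>k(z, w) = \<rho>\<^bsup>2n\<^esup> (1 - \<rho>\<^sup>2)\<^bsup>\<alpha>+1\<^esup>\<close> with \<open>\<rho> = \<rho>(z, w)\<close>.
  Let \<open>z\<^sub>0\<close> be the centre of the empty disk, and take about \<open>\<pi> / (1 - r\<^sup>2)\<close> equally spaced points \<open>w\<^sub>j\<close>
  on the pseudohyperbolic circle of radius \<open>r \<le> R\<close> about \<open>z\<^sub>0\<close>. Every \<open>z\<close> outside the disk has some \<open>w\<^sub>j\<close>
  with \<open>1 - \<rho>(z, z\<^sub>0)\<^sup>2 \<le> 2 (1 - r\<^sup>2) (1 - \<rho>(z, w\<^sub>j)\<^sup>2)\<close>, and if \<open>\<rho>(z, w\<^sub>j) \<ge> d\<close> there, then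
  \<open>d\<^bsup>2n\<^esup> k(z, z\<^sub>0) \<le> (2 (1 - r\<^sup>2))\<^bsup>\<alpha>+1\<^esup> \<Sum>\<^sub>j k(z, w\<^sub>j)\<close> off the disk. Integrating against \<open>\<mu>\<close>, the lower
  sampling bound at \<open>z\<^sub>0\<close> and the upper bounds at the \<open>w\<^sub>j\<close> give
  \<open>d\<^bsup>2n\<^esup> A \<le> 2 (\<pi> + 1) (2 (1 - r\<^sup>2))\<^bsup>\<alpha>\<^esup> B\<close>. Take \<open>r = R\<close> if \<open>n = 0\<close>, and
  \<open>1 - r = 7/5 (1 - R)\<close>, \<open>d = 1/6\<close> otherwise.
\<close>

section \<open>Laplace and Fourier transforms of powers\<close>

text \<open>Differentiation under the integral sign. The bound \<open>B\<close> on the second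
  derivative makes the first-order Taylor remainder at most |w - z|^2 \<open>B x\<close>, and
  integrating this leaves a difference quotient that is off by O(|w - z|).\<close>

lemma has_field_derivative_lebesgue_integral:
  fixes f0 f1 f2 :: "complex \<Rightarrow> 'a \<Rightarrow> complex"
  assumes "0 < d"
    and f0: "\<And>w x. w \<in> ball z d \<Longrightarrow> x \<in> space M \<Longrightarrow> ((\<lambda>w. f0 w x) has_field_derivative f1 w x) (at w)"
    and f1: "\<And>w x. w \<in> ball z d \<Longrightarrow> x \<in> space M \<Longrightarrow> ((\<lambda>w. f1 w x) has_field_derivative f2 w x) (at w)"
    and f2: "\<And>w x. w \<in> ball z d \<Longrightarrow> x \<in> space M \<Longrightarrow> cmod (f2 w x) \<le> B x"
    and int: "\<And>w. w \<in> ball z d \<Longrightarrow> integrable M (f0 w)" "integrable M (f1 z)" "integrable M B"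
  shows "((\<lambda>w. \<integral>x. f0 w x \<partial>M) has_field_derivative (\<integral>x. f1 z x \<partial>M)) (at z)"
proof -
  define F where "F w = (\<integral>x. f0 w x \<partial>M)" for w
  define D where "D = (\<integral>x. f1 z x \<partial>M)"
  have z: "z \<in> ball z d" using \<open>0 < d\<close> by simp
  have est: "cmod (F w - F z - (w - z) * D) \<le> (cmod (w - z))\<^sup>2 * (\<integral>x. B x \<partial>M)" if w: "w \<in> ball z d" for w
  proof -
    have pt: "cmod (f0 w x - f0 z x - (w - z) * f1 z x) \<le> (cmod (w - z))\<^sup>2 * B x"
      if x: "x \<in> space M" for x
    proof -
      \<comment> \<open>\<open>complex_Taylor\<close> expects the successive derivatives as a
        sequence.\<close>
      define f where "f i v = (if i = 0 then f0 v x else if i = 1 then f1 v x else f2 v x)" for i :: nat and v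
      have "cmod (f 0 w - (\<Sum>i\<le>1. f i z * (w - z) ^ i / fact i)) \<le> B x * cmod (w - z) ^ Suc 1 / fact 1"
      proof (rule complex_Taylor)
        show "convex (ball z d)" by simp
        show "(f i has_field_derivative f (Suc i) v) (at v within ball z d)"
          if "v \<in> ball z d" "i \<le> 1" for i v
        proof -
          from \<open>i \<le> 1\<close> consider "i = 0" | "i = 1" by linarith
          then show ?thesis
            using f0[OF that(1) x] f1[OF that(1) x]
            by cases (auto simp: f_def[abs_def] has_field_derivative_at_within)
        qed
        show "cmod (f (Suc 1) v) \<le> B x" if "v \<in> ball z d" for v
          using f2[OF that x] by (simp add: f_def)
      qed (use w z in auto)
      then show ?thesis by (simp add: f_def algebra_simps power2_eq_square)
    qed
    have "F w - F z - (w - z) * D = (\<integral>x. f0 w x - f0 z x - (w - z) * f1 z x \<partial>M)"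
      using int(1)[OF w] int(1)[OF z] int(2) by (simp add: F_def D_def)
    also have "cmod \<dots> \<le> (\<integral>x. cmod (f0 w x - f0 z x - (w - z) * f1 z x) \<partial>M)"
      by (rule integral_norm_bound)
    also have "\<dots> \<le> (\<integral>x. (cmod (w - z))\<^sup>2 * B x \<partial>M)"
      using int(1)[OF w] int(1)[OF z] int(2,3) by (intro integral_mono pt) auto
    finally show ?thesis by simp
  qed
  have "((\<lambda>w. (F w - F z) / (w - z) - D) \<longlongrightarrow> 0) (at z)"
  proof (rule Lim_null_comparison)
    show "eventually (\<lambda>w. norm ((F w - F z) / (w - z) - D) \<le> cmod (w - z) * (\<integral>x. B x \<partial>M)) (at z)"
      unfolding eventually_at
    proof (intro exI[of _ d] conjI ballI impI)
      fix w assume "w \<noteq> z \<and> dist w z < d"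
      then have w: "w \<noteq> z" "w \<in> ball z d" by (auto simp: dist_commute)
      have "norm ((F w - F z) / (w - z) - D) = cmod (F w - F z - (w - z) * D) / cmod (w - z)"
        using w(1) by (simp add: norm_divide[symmetric] diff_divide_distrib)
      also have "\<dots> \<le> (cmod (w - z))\<^sup>2 * (\<integral>x. B x \<partial>M) / cmod (w - z)"
        by (intro divide_right_mono est w) auto
      finally show "norm ((F w - F z) / (w - z) - D) \<le> cmod (w - z) * (\<integral>x. B x \<partial>M)"
        using w(1) by (simp add: power2_eq_square)
    qed (use \<open>0 < d\<close> in auto)
    show "((\<lambda>w. cmod (w - z) * (\<integral>x. B x \<partial>M)) \<longlongrightarrow> 0) (at z)"
      by (auto intro!: tendsto_eq_intros)
  qed
  then have "((\<lambda>w. (F w - F z) / (w - z)) \<longlongrightarrow> D) (at z)"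
    by (simp add: LIM_zero_iff)
  then show ?thesis
    by (simp add: has_field_derivative_iff F_def[abs_def] D_def)
qed

definition gamma_kernel :: "real \<Rightarrow> complex \<Rightarrow> real \<Rightarrow> complex" where
  "gamma_kernel b q x = (if 0 < x then of_real (x powr b) * exp (- (q * of_real x)) else 0)"

lemma gamma_kernel_measurable [measurable]: "gamma_kernel b q \<in> borel_measurable lborel"
  unfolding gamma_kernel_def[abs_def] by measurable

text \<open>Euler's integral for the Gamma function after the substitution t = a x.\<close>

lemma gamma_kernel_real:
  assumes "-1 < b" "0 < a"
  shows "has_bochner_integral lborel (gamma_kernel b (of_real a)) (of_real (Gamma (b + 1) * a powr (- (b + 1))))"
proof -
  have 1: "((\<lambda>t. t powr b / exp t) has_integral Gamma (b + 1)) {0..}"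
    using Gamma_integral_real[of "b + 1"] assms by simp
  have "has_bochner_integral lborel (\<lambda>t. indicator {0..} t * (t powr b / exp t)) (Gamma (b + 1))"
  proof (rule has_bochner_integral_nn_integral)
    show "(\<integral>\<^sup>+ x. ennreal (indicator {0..} x * (x powr b / exp x)) \<partial>lborel) = ennreal (Gamma (b + 1))"
      using nn_integral_has_integral_lebesgue[OF _ 1] by simp
    show "0 \<le> Gamma (b + 1)" using assms by (simp add: Gamma_real_pos less_imp_le)
  qed auto
  then have "has_bochner_integral lborel (\<lambda>t. indicator {0..} (a * t) * ((a * t) powr b / exp (a * t))) (Gamma (b + 1) / a)"
    using lborel_has_bochner_integral_real_affine_iff[of a "\<lambda>t. indicator {0..} t * (t powr b / exp t)" _ 0] assms
    by simp (simp add: divide_inverse mult.commute)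
  then have "has_bochner_integral lborel (\<lambda>t. a powr (-b) *
     (indicator {0..} (a * t) * ((a * t) powr b / exp (a * t)))) (a powr (-b) * (Gamma (b + 1) / a))"
    by (rule has_bochner_integral_mult_right)
  then have "has_bochner_integral lborel (\<lambda>t. complex_of_real (a powr (-b) *
     (indicator {0..} (a * t) * ((a * t) powr b / exp (a * t))))) (of_real (a powr (-b) * (Gamma (b + 1) / a)))"
    by (rule has_bochner_integral_of_real)
  also have "(\<lambda>t. complex_of_real (a powr (-b) *
     (indicator {0..} (a * t) * ((a * t) powr b / exp (a * t))))) = gamma_kernel b (of_real a)"
    (is "?l = _")
  proof
    fix t
    show "?l t = gamma_kernel b (of_real a) t"
    proof (cases "0 < t")
      case True
      then show ?thesis using assms
        by (simp add: gamma_kernel_def powr_mult powr_minus exp_minus field_simps exp_of_real flip: of_real_mult)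
    next
      case False
      \<comment> \<open>At t = 0 the left side vanishes because \<open>0 powr b = 0\<close> for
        every b, which matches the cut-off in \<open>gamma_kernel\<close>.\<close>
      then consider "t = 0" | "t < 0" by linarith
      then show ?thesis using assms by cases (simp_all add: gamma_kernel_def indicator_def zero_le_mult_iff)
    qed
  qed
  also have "a powr (-b) * (Gamma (b + 1) / a) = Gamma (b + 1) * a powr (- (b + 1))"
    using assms by (simp add: powr_diff powr_minus field_simps powr_add)
  finally show ?thesis .
qed

lemma norm_gamma_kernel: "cmod (gamma_kernel b q x) = cmod (gamma_kernel b (of_real (Re q)) x)"
  by (simp add: gamma_kernel_def norm_mult)

lemma integrable_gamma_kernel:
  assumes "-1 < b" "0 < Re q"
  shows "integrable lborel (gamma_kernel b q)"
proof (rule Bochner_Integration.integrable_bound)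
  show "integrable lborel (gamma_kernel b (of_real (Re q)))"
    using gamma_kernel_real[OF assms] by (simp add: has_bochner_integral_iff)
qed (auto simp: norm_gamma_kernel[of b q])

lemma gamma_kernel_deriv:
  "((\<lambda>q. gamma_kernel b q x) has_field_derivative - gamma_kernel (b + 1) q x) (at q)"
proof (cases "0 < x")
  case True
  then show ?thesis
    unfolding gamma_kernel_def
    by (auto intro!: derivative_eq_intros simp: powr_add)
qed (simp add: gamma_kernel_def)

text \<open>Both sides are holomorphic in q on the right half-plane and agree on the positive reals
  by \<open>gamma_kernel_real\<close>, so the identity theorem applies.\<close>

lemma Gamma_Laplace:
  assumes b: "-1 < b" and q: "0 < Re q"
  shows "(\<integral>x. gamma_kernel b q x \<partial>lborel) = of_real (Gamma (b + 1)) * q powr (- of_real (b + 1))"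
proof -
  define S where "S = {q::complex. 0 < Re q}"
  have S: "open S" "connected S"
    unfolding S_def by (auto simp: open_halfspace_Re_gt intro!: convex_connected convex_halfspace_Re_gt)
  define F where "F q = (\<integral>x. gamma_kernel b q x \<partial>lborel)" for q
  have hol: "F holomorphic_on S"
  proof -
    have "(F has_field_derivative (\<integral>x. - gamma_kernel (b + 1) q x \<partial>lborel)) (at q)" if "q \<in> S" for q
      unfolding F_def
    \<comment> \<open>On the ball of radius Re q / 2 about q the real part stays above Re q / 2, so
      the real kernel at Re q / 2 dominates.\<close>
    proof (rule has_field_derivative_lebesgue_integral[where d = "Re q / 2" and
          B = "\<lambda>x. cmod (gamma_kernel (b + 2) (of_real (Re q / 2)) x)"])
      show "0 < Re q / 2" using that by (simp add: S_def)
      show "((\<lambda>w. gamma_kernel b w x) has_field_derivative - gamma_kernel (b + 1) w x) (at w)" for w x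
        by (rule gamma_kernel_deriv)
      show "((\<lambda>w. - gamma_kernel (b + 1) w x) has_field_derivative gamma_kernel (b + 2) w x) (at w)" for w x
        using DERIV_minus[OF gamma_kernel_deriv[of "b + 1" x w]] by (simp add: add.assoc)
      have Re: "Re q / 2 < Re w" if w: "w \<in> ball q (Re q / 2)" for w
      proof -
        have "\<bar>Re (q - w)\<bar> < Re q / 2"
          using abs_Re_le_cmod[of "q - w"] w by (simp add: dist_norm)
        then show ?thesis using abs_ge_self[of "Re q - Re w"] by simp
      qed
      show "cmod (gamma_kernel (b + 2) w x) \<le> cmod (gamma_kernel (b + 2) (of_real (Re q / 2)) x)"
        if "w \<in> ball q (Re q / 2)" for w x
        using Re[OF that] by (simp add: gamma_kernel_def norm_mult mult_right_mono mult_left_mono)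
      show "integrable lborel (gamma_kernel b w)" if "w \<in> ball q (Re q / 2)" for w
        using Re[OF that] \<open>q \<in> S\<close> b by (intro integrable_gamma_kernel) (auto simp: S_def)
      show "integrable lborel (\<lambda>x. - gamma_kernel (b + 1) q x)"
        using \<open>q \<in> S\<close> b by (intro Bochner_Integration.integrable_minus integrable_gamma_kernel) (auto simp: S_def)
      show "integrable lborel (\<lambda>x. cmod (gamma_kernel (b + 2) (of_real (Re q / 2)) x))"
        using \<open>q \<in> S\<close> b by (intro integrable_norm integrable_gamma_kernel) (auto simp: S_def)
    qed
    then show ?thesis
      by (auto simp: holomorphic_on_def field_differentiable_def intro: has_field_derivative_at_within)
  qed
  have nonpos: "q \<notin> \<real>\<^sub>\<le>\<^sub>0" if "q \<in> S" for q
    using that by (auto simp: S_def complex_nonpos_Reals_iff)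
  have "F q - of_real (Gamma (b + 1)) * q powr (- of_real (b + 1)) = 0"
  proof (rule analytic_continuation[where S = S and U = "of_real ` {0<..}" and \<xi> = 1
        and f = "\<lambda>q. F q - of_real (Gamma (b + 1)) * q powr (- of_real (b + 1))"])
    show "(\<lambda>q. F q - of_real (Gamma (b + 1)) * q powr (- of_real (b + 1))) holomorphic_on S"
      using nonpos by (intro holomorphic_intros hol) auto
    show "(1::complex) islimpt of_real ` {0<..}"
      unfolding islimpt_approachable
    proof safe
      fix e :: real assume "0 < e"
      then have "of_real (1 + e / 2) \<in> complex_of_real ` {0<..}" by (intro imageI) auto
      moreover have "dist (complex_of_real (1 + e / 2)) 1 < e" "complex_of_real (1 + e / 2) \<noteq> 1"
        using \<open>0 < e\<close> by (auto simp: dist_norm)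
      ultimately show "\<exists>x'\<in>complex_of_real ` {0<..}. x' \<noteq> 1 \<and> dist x' 1 < e" by blast
    qed
    show "F z - of_real (Gamma (b + 1)) * z powr (- of_real (b + 1)) = 0" if "z \<in> of_real ` {0<..}" for z
    proof -
      from that obtain a where a: "z = of_real a" "0 < a" by auto
      have "z powr (- of_real (b + 1)) = of_real (a powr (- (b + 1)))"
        using a powr_of_real[of a "- (b + 1)"] by simp
      then show ?thesis
        using has_bochner_integral_integral_eq[OF gamma_kernel_real[OF b a(2)]] by (simp add: F_def a(1))
    qed
  qed (use S q in \<open>auto simp: S_def\<close>)
  then show ?thesis by (simp add: F_def)
qed

section \<open>Powers on vertical lines and their Fourier transforms\<close>

lemma integrable_vertical_line_powr:
  assumes p: "1 < p" and z: "0 < Re z"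
  shows "integrable lborel (\<lambda>t. cmod (z - \<i> * of_real t) powr (- p))"
proof -
  define a where "a = Re z"
  define g where "g t = indicator {1..} t * (t powr (- p))" for t :: real
  have "integrable lborel g"
  proof -
    have "(\<lambda>t. t powr (- p)) integrable_on {1..}"
      using has_integral_powr_to_inf[of "- p" 1] p by (auto simp: integrable_on_def)
    then have "(\<lambda>t. t powr (- p)) absolutely_integrable_on {1..}"
      by (rule nonnegative_absolutely_integrable_1) auto
    then have "integrable lebesgue g"
      by (simp add: set_integrable_def g_def[abs_def])
    then show ?thesis
      by (subst (asm) integrable_completion) (auto simp: g_def[abs_def])
  qed
  then have g: "integrable lborel g" "integrable lborel (\<lambda>t. g (- t))"
    using lborel_integrable_real_affine_iff[of "-1" g 0] by auto
  have "integrable lborel (\<lambda>t. cmod (of_real a - \<i> * of_real t) powr (- p))"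
  \<comment> \<open>Majorant: on [-1, 1] the modulus is at least a, and outside it is at least
    |t|.\<close>
  proof (rule Bochner_Integration.integrable_bound)
    show "integrable lborel (\<lambda>t. indicator {-1..1} t * a powr (- p) + (g t + g (- t)))"
      by (intro Bochner_Integration.integrable_add g integrable_mult_left) auto
    have "cmod (of_real a - \<i> * of_real t) powr (- p) \<le> indicator {-1..1} t * a powr (- p) + (g t + g (- t))" for t
    proof -
      have m: "a \<le> cmod (of_real a - \<i> * of_real t)" "\<bar>t\<bar> \<le> cmod (of_real a - \<i> * of_real t)"
        using complex_Re_le_cmod[of "of_real a - \<i> * of_real t"] abs_Im_le_cmod[of "of_real a - \<i> * of_real t"] by auto
      consider "-1 \<le> t" "t \<le> 1" | "1 < t" | "t < -1" by linarith
      then show ?thesis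
      proof cases
        case 1
        have "cmod (of_real a - \<i> * of_real t) powr (- p) \<le> a powr (- p)"
          using m(1) z p by (intro powr_mono2') (auto simp: a_def)
        moreover have "0 \<le> g t + g (- t)" by (simp add: g_def)
        ultimately show ?thesis using 1 by simp
      next
        case 2
        have "cmod (of_real a - \<i> * of_real t) powr (- p) \<le> \<bar>t\<bar> powr (- p)"
          using m(2) p 2 by (intro powr_mono2') auto
        with 2 show ?thesis by (simp add: g_def indicator_def)
      next
        case 3
        have "cmod (of_real a - \<i> * of_real t) powr (- p) \<le> \<bar>t\<bar> powr (- p)"
          using m(2) p 3 by (intro powr_mono2') auto
        with 3 show ?thesis by (simp add: g_def indicator_def)
      qed
    qed
    then show "AE t in lborel. norm (cmod (of_real a - \<i> * of_real t) powr (- p)) \<le> norm (indicator {-1..1} t * a powr (- p) + (g t + g (- t)))"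
      by (auto intro!: AE_I2 order.trans[OF _ abs_ge_self])
  qed measurable
  \<comment> \<open>A translation by Im z reduces the line through z to the line through the real
    number a.\<close>
  then have "integrable lborel (\<lambda>t. cmod (of_real a - \<i> * of_real (- Im z + 1 * t)) powr (- p))"
    by (rule lborel_integrable_real_affine) simp
  moreover have "of_real a - \<i> * of_real (- Im z + 1 * t) = z - \<i> * of_real t" for t
    by (simp add: complex_eq_iff a_def)
  ultimately show ?thesis by simp
qed

text \<open>The integrand of Laplace's contour integral for the reciprocal Gamma function along a
  vertical line.\<close>

definition powexp :: "real \<Rightarrow> complex \<Rightarrow> complex" where
  "powexp p z = z powr (- of_real p) * exp z"

lemma Re_pos_nonpos: "0 < Re z \<Longrightarrow> z \<notin> \<real>\<^sub>\<le>\<^sub>0"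
  by (auto simp: complex_nonpos_Reals_iff)

lemma norm_powexp:
  assumes "0 < Re z"
  shows "cmod (powexp p z) = cmod z powr (- p) * exp (Re z)"
proof -
  have "cmod (z powr of_real (- p)) = cmod z powr (- p)" by (subst norm_powr_real_powr') auto
  then show ?thesis by (simp add: powexp_def norm_mult)
qed

lemma powexp_measurable [measurable]: "(\<lambda>t. powexp p (a - \<i> * of_real t)) \<in> borel_measurable lborel"
  unfolding powexp_def by measurable

lemma integrable_powexp:
  assumes "1 < p" "0 < Re a"
  shows "integrable lborel (\<lambda>t. powexp p (a - \<i> * of_real t))"
proof (rule Bochner_Integration.integrable_bound)
  show "integrable lborel (\<lambda>t. cmod (a - \<i> * of_real t) powr (- p) * exp (Re a))"
    by (intro integrable_mult_left integrable_vertical_line_powr assms)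
qed (use assms in \<open>auto simp: norm_powexp\<close>)

lemma powexp_deriv:
  assumes "0 < Re z"
  shows "(powexp p has_field_derivative powexp p z - of_real p * powexp (p + 1) z) (at z)"
proof -
  have "((\<lambda>z. z powr (- of_real p) * exp z) has_field_derivative
     z powr (- of_real p) * exp z + (- of_real p * z powr (- of_real p - 1)) * exp z) (at z)"
    by (auto intro!: derivative_eq_intros has_field_derivative_powr Re_pos_nonpos assms)
  moreover have "- complex_of_real p - 1 = - of_real (p + 1)" by simp
  ultimately show ?thesis
    by (simp add: powexp_def[abs_def] algebra_simps)
qed

text \<open>The integrand is the t-derivative of \<i>
  \<open>powexp p (a - \<i> * of_real t)\<close>, which decays like |t|^(-p) at both ends, so the
  fundamental theorem of calculus gives 0.\<close>

lemma powexp_line_integral_deriv: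
  assumes p: "1 < p" and a: "0 < Re a"
  shows "(\<integral>t. (powexp p (a - \<i> * of_real t) - of_real p * powexp (p + 1) (a - \<i> * of_real t)) \<partial>lborel) = 0"
proof -
  define F where "F t = \<i> * powexp p (a - \<i> * of_real t)" for t
  define f where "f t = powexp p (a - \<i> * of_real t) - of_real p * powexp (p + 1) (a - \<i> * of_real t)" for t
  have cont: "isCont (\<lambda>t. powexp q (a - \<i> * of_real t)) t" for t q
  proof -
    have "isCont (powexp q) (a - \<i> * of_real t)"
      using powexp_deriv[of "a - \<i> * of_real t" q] a by (auto intro: DERIV_isCont)
    then show ?thesis
      by (rule isCont_o2[rotated]) (auto intro!: continuous_intros)
  qed
  \<comment> \<open>Stated for an arbitrary filter so that one argument serves both ends of the
    line.\<close>
  have lim: "(F \<longlongrightarrow> 0) L" if "filterlim (\<lambda>t. \<bar>t\<bar>) at_top L" for L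
  proof (rule tendsto_norm_zero_cancel)
    have "filterlim (\<lambda>t. \<bar>t\<bar> - \<bar>Im a\<bar>) at_top L"
      using filterlim_tendsto_add_at_top[OF tendsto_const that, of "- \<bar>Im a\<bar>"] by simp
    then have "filterlim (\<lambda>t. cmod (a - \<i> * of_real t)) at_top L"
    proof (rule filterlim_at_top_mono)
      show "\<forall>\<^sub>F t in L. \<bar>t\<bar> - \<bar>Im a\<bar> \<le> cmod (a - \<i> * of_real t)"
      proof (rule always_eventually, rule)
        fix t show "\<bar>t\<bar> - \<bar>Im a\<bar> \<le> cmod (a - \<i> * of_real t)"
          using abs_Im_le_cmod[of "a - \<i> * of_real t"] by simp
      qed
    qed
    then have "((\<lambda>t. cmod (a - \<i> * of_real t) powr (- p) * exp (Re a)) \<longlongrightarrow> 0 * exp (Re a)) L"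
      using p by (intro tendsto_mult tendsto_const tendsto_neg_powr) auto
    then show "((\<lambda>t. cmod (F t)) \<longlongrightarrow> 0) L"
      using a by (simp add: F_def norm_mult norm_powexp)
  qed
  have "(LBINT t=-\<infinity>..\<infinity>. f t) = 0 - 0"
  proof (rule interval_integral_FTC_integrable[where F = F])
    show "(F has_vector_derivative f t) (at t)" for t
    proof -
      have "((\<lambda>t. \<i> * powexp p (a - \<i> * t)) has_field_derivative f t) (at (of_real t))"
        unfolding f_def
        by (rule derivative_eq_intros DERIV_chain2[OF powexp_deriv] | simp add: a algebra_simps)+
      then show ?thesis
        unfolding F_def[abs_def] by (rule has_vector_derivative_real_field)
    qed
    show "isCont f t" for t unfolding f_def[abs_def] by (intro continuous_intros cont)
    show "set_integrable lborel (einterval (-\<infinity>) \<infinity>) f"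
      using p a by (simp add: einterval_def set_integrable_def f_def[abs_def] integrable_powexp)
    show "((F \<circ> real_of_ereal) \<longlongrightarrow> 0) (at_right (-\<infinity>))"
      unfolding ereal_tendsto_simps by (rule lim) (auto intro!: filterlim_at_top_mono[OF filterlim_uminus_at_top_at_bot] always_eventually)
    show "((F \<circ> real_of_ereal) \<longlongrightarrow> 0) (at_left \<infinity>)"
      unfolding ereal_tendsto_simps by (rule lim) (auto intro!: filterlim_at_top_mono[OF filterlim_ident] always_eventually)
  qed auto
  then show ?thesis
    by (simp add: interval_lebesgue_integral_def set_lebesgue_integral_def einterval_def f_def)
qed

text \<open>This does the work of shifting the contour: by \<open>powexp_line_integral_deriv\<close>
  the derivative of the line integral in a vanishes on the convex half-plane.\<close>

lemma powexp_line_integral_const: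
  assumes p: "1 < p"
  obtains C where "\<And>a. 0 < Re a \<Longrightarrow> (\<integral>t. powexp p (a - \<i> * of_real t) \<partial>lborel) = C"
proof -
  define H where "H a = (\<integral>t. powexp p (a - \<i> * of_real t) \<partial>lborel)" for a
  \<comment> \<open>\<open>Q1\<close> and \<open>Q2\<close> are the first and second derivatives of
    the integrand in a.\<close>
  define Q1 where "Q1 a t = powexp p (a - \<i> * of_real t) - of_real p * powexp (p + 1) (a - \<i> * of_real t)" for a t
  define Q2 where "Q2 a t = Q1 a t - of_real p * (powexp (p + 1) (a - \<i> * of_real t) - of_real (p + 1) * powexp (p + 1 + 1) (a - \<i> * of_real t))" for a t
  have D: "(H has_field_derivative 0) (at a)" if a: "0 < Re a" for a
  proof -
    \<comment> \<open>\<open>e q\<close> dominates \<open>powexp q\<close> for all w with |w - a| <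
      Re a / 2: there |w - \<i> t| is at least |a - \<i> t| / 2, which costs the factor 2^q, and Re
      w < 2 Re a.\<close>
    define e where "e q t = cmod (a - \<i> * of_real t) powr (- q) * (2 powr q * exp (2 * Re a))" for q t
    have "(H has_field_derivative (\<integral>t. Q1 a t \<partial>lborel)) (at a)"
      unfolding H_def[abs_def]
    proof (rule has_field_derivative_lebesgue_integral[where d = "Re a / 2" and ?f2.0 = Q2
          and B = "\<lambda>t. e p t + p * e (p + 1) t + p * (e (p + 1) t + (p + 1) * e (p + 1 + 1) t)"])
      fix w assume w: "w \<in> ball a (Re a / 2)"
      have d: "cmod (a - w) < Re a / 2" using w by (simp add: dist_norm)
      then have Re: "0 < Re w" "Re w < 2 * Re a"
        using abs_Re_le_cmod[of "a - w"] abs_ge_self[of "Re a - Re w"] abs_ge_minus_self[of "Re a - Re w"] a by auto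
      have chain: "((\<lambda>w. powexp q (w - \<i> * of_real t)) has_field_derivative
         powexp q (w - \<i> * of_real t) - of_real q * powexp (q + 1) (w - \<i> * of_real t)) (at w)" for q t
      proof -
        have "((\<lambda>w. w - \<i> * of_real t) has_field_derivative 1) (at w)"
          by (auto intro!: derivative_eq_intros)
        moreover have "0 < Re (w - \<i> * of_real t)" using Re by simp
        ultimately show ?thesis using DERIV_chain2[OF powexp_deriv] by fastforce
      qed
      show "((\<lambda>w. powexp p (w - \<i> * of_real t)) has_field_derivative Q1 w t) (at w)" for t
        unfolding Q1_def by (rule chain)
      show "((\<lambda>w. Q1 w t) has_field_derivative Q2 w t) (at w)" for t
        unfolding Q1_def Q2_def by (intro DERIV_diff DERIV_cmult chain)
      show "integrable lborel (\<lambda>t. powexp p (w - \<i> * of_real t))"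
        using Re p by (intro integrable_powexp)
      have e: "cmod (powexp q (w - \<i> * of_real t)) \<le> e q t" if "0 < q" for q t
      proof -
        have "cmod (a - \<i> * of_real t) \<le> cmod (a - w) + cmod (w - \<i> * of_real t)"
          using norm_triangle_ineq[of "a - w" "w - \<i> * of_real t"] by simp
        moreover have "Re a \<le> cmod (a - \<i> * of_real t)"
          using complex_Re_le_cmod[of "a - \<i> * of_real t"] by simp
        ultimately have *: "cmod (a - \<i> * of_real t) / 2 \<le> cmod (w - \<i> * of_real t)" "0 < cmod (a - \<i> * of_real t)"
          using d a by linarith+
        have "cmod (powexp q (w - \<i> * of_real t)) = cmod (w - \<i> * of_real t) powr (- q) * exp (Re w)"
          using Re by (simp add: norm_powexp)
        also have "\<dots> \<le> (cmod (a - \<i> * of_real t) / 2) powr (- q) * exp (2 * Re a)"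
          using * that Re by (intro mult_mono powr_mono2') auto
        also have "\<dots> = e q t"
          using * by (simp add: e_def powr_divide powr_minus field_simps)
        finally show ?thesis .
      qed
      show "cmod (Q2 w t) \<le> e p t + p * e (p + 1) t + p * (e (p + 1) t + (p + 1) * e (p + 1 + 1) t)" for t
      proof -
        have "cmod (Q2 w t) \<le> (cmod (powexp p (w - \<i> * of_real t)) + p * cmod (powexp (p + 1) (w - \<i> * of_real t)))
            + p * (cmod (powexp (p + 1) (w - \<i> * of_real t)) + (p + 1) * cmod (powexp (p + 1 + 1) (w - \<i> * of_real t)))"
        proof -
          have tri: "cmod (x - of_real c * y) \<le> X + c * Y" if "cmod x \<le> X" "cmod y \<le> Y" "0 \<le> c" for x y X Y c
          proof -
            have "cmod (x - of_real c * y) \<le> cmod x + cmod (of_real c * y)" by (rule norm_triangle_ineq4)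
            also have "\<dots> \<le> X + c * Y" using that by (intro add_mono) (auto simp: norm_mult intro!: mult_left_mono)
            finally show ?thesis .
          qed
          show ?thesis unfolding Q2_def Q1_def using p by (intro tri order.refl) auto
        qed
        also have "\<dots> \<le> e p t + p * e (p + 1) t + p * (e (p + 1) t + (p + 1) * e (p + 1 + 1) t)"
          using p by (intro add_mono mult_left_mono e) auto
        finally show ?thesis .
      qed
    next
      show "integrable lborel (Q1 a)"
        unfolding Q1_def[abs_def] using a p
        by (intro Bochner_Integration.integrable_diff integrable_mult_right integrable_powexp) auto
      show "integrable lborel (\<lambda>t. e p t + p * e (p + 1) t + p * (e (p + 1) t + (p + 1) * e (p + 1 + 1) t))"
        unfolding e_def[abs_def] using a p
        by (intro Bochner_Integration.integrable_add integrable_mult_right integrable_mult_left integrable_vertical_line_powr) auto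
    qed (use a in auto)
    then show ?thesis
      using powexp_line_integral_deriv[OF p a] by (simp add: Q1_def)
  qed
  have "\<exists>C. \<forall>a\<in>{a. 0 < Re a}. H a = C"
    by (rule has_field_derivative_zero_constant[OF convex_halfspace_Re_gt]) (auto intro: has_field_derivative_at_within D)
  then show thesis using that by (auto simp: H_def)
qed

text \<open>The constant is \<open>2 \<pi> / \<Gamma> p\<close>, but it cancels in the end, so Fourier inversion can be avoided.\<close>

lemma fourier_powr:
  assumes p: "1 < p"
  obtains C where "\<And>a \<xi>. 0 < Re a \<Longrightarrow> 0 < \<xi> \<Longrightarrow>
     (\<integral>t. (a - \<i> * of_real t) powr (- of_real p) * exp (- (\<i> * of_real t * of_real \<xi>)) \<partial>lborel)
       = C * of_real (\<xi> powr (p - 1)) * exp (- (a * of_real \<xi>))"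
proof -
  obtain C where C: "\<And>a. 0 < Re a \<Longrightarrow> (\<integral>t. powexp p (a - \<i> * of_real t) \<partial>lborel) = C"
    using powexp_line_integral_const[OF p] by blast
  show thesis
  proof (rule that)
    fix a :: complex and \<xi> :: real assume a: "0 < Re a" and \<xi>: "0 < \<xi>"
    let ?I = "\<integral>t. (a - \<i> * of_real t) powr (- of_real p) * exp (- (\<i> * of_real t * of_real \<xi>)) \<partial>lborel"
    \<comment> \<open>On the line through a \<xi>, the substitution t to \<xi> t turns the
      exponential in \<open>powexp\<close> into the Fourier factor at frequency \<xi>. The term
      \<open>0 + \<xi> * t\<close> has the shape required by the affine change of variables.\<close>
    have pw: "powexp p (a * of_real \<xi> - \<i> * of_real (0 + \<xi> * t)) =
      of_real (\<xi> powr (- p)) * exp (a * of_real \<xi>) * ((a - \<i> * of_real t) powr (- of_real p) * exp (- (\<i> * of_real t * of_real \<xi>)))" for t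
    proof -
      have 1: "a * of_real \<xi> - \<i> * of_real (0 + \<xi> * t) = of_real \<xi> * (a - \<i> * of_real t)" by (simp add: algebra_simps)
      have "a - \<i> * of_real t \<noteq> 0" using a by (auto simp: complex_eq_iff)
      then have "(of_real \<xi> * (a - \<i> * of_real t)) powr (- of_real p) = of_real (\<xi> powr (- p)) * (a - \<i> * of_real t) powr (- of_real p)"
        using powr_times_real_left[of "of_real \<xi>"] powr_of_real[of \<xi> "- p"] \<xi> by simp
      moreover have "exp (of_real \<xi> * (a - \<i> * of_real t)) = exp (a * of_real \<xi>) * exp (- (\<i> * of_real t * of_real \<xi>))"
        by (simp add: algebra_simps flip: exp_add)
      ultimately show ?thesis unfolding powexp_def 1 by simp
    qed
    have "C = (\<integral>t. powexp p (a * of_real \<xi> - \<i> * of_real t) \<partial>lborel)"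
      using C[of "a * of_real \<xi>"] a \<xi> by simp
    also have "\<dots> = \<bar>\<xi>\<bar> *\<^sub>R (\<integral>t. powexp p (a * of_real \<xi> - \<i> * of_real (0 + \<xi> * t)) \<partial>lborel)"
      using \<xi> by (intro lborel_integral_real_affine) auto
    also have "\<dots> = of_real (\<xi> * \<xi> powr (- p)) * exp (a * of_real \<xi>) * ?I"
      unfolding pw using \<xi> by (simp add: scaleR_conv_of_real)
    finally have "C * of_real (\<xi> powr (p - 1)) * exp (- (a * of_real \<xi>)) =
       of_real (\<xi> * \<xi> powr (- p) * \<xi> powr (p - 1)) * (exp (a * of_real \<xi>) * exp (- (a * of_real \<xi>))) * ?I"
      by simp
    also have "\<xi> * \<xi> powr (- p) * \<xi> powr (p - 1) = 1"
      using \<xi> by (simp add: powr_mult_base mult.assoc flip: powr_add)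
    finally show "?I = C * of_real (\<xi> powr (p - 1)) * exp (- (a * of_real \<xi>))"
      by (simp flip: exp_add)
  qed
qed

section \<open>Pseudohyperbolic geometry\<close>

text \<open>This is 1 - \<rho>(z, w)^2, by \<open>ph_defect_eq\<close>. The closed form exhibits the
  powers of Im z and Im w that come out of the wavelet transform.\<close>

definition ph_defect :: "complex \<Rightarrow> complex \<Rightarrow> real" where
  "ph_defect z w = 4 * Im z * Im w / (cmod (z - cnj w))\<^sup>2"

lemma ph_defect_pos: "0 < Im z \<Longrightarrow> 0 < Im w \<Longrightarrow> 0 < ph_defect z w"
  by (auto simp: ph_defect_def complex_eq_iff)

lemma norm_diff_cnj_sq: "(cmod (z - cnj w))\<^sup>2 = (cmod (z - w))\<^sup>2 + 4 * Im z * Im w"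
  by (simp add: cmod_power2) (simp add: power2_eq_square algebra_simps)

lemma ph_defect_eq:
  assumes "0 < Im z" "0 < Im w"
  shows "ph_defect z w = 1 - (cmod ((z - w) / (z - cnj w)))\<^sup>2"
proof -
  have "0 < 4 * Im z * Im w" using assms by simp
  then have "0 < (cmod (z - cnj w))\<^sup>2"
    using norm_diff_cnj_sq[of z w] by (smt (verit) zero_le_power2)
  then show ?thesis
    using norm_diff_cnj_sq[of z w] by (simp add: ph_defect_def norm_divide power_divide field_simps)
qed

text \<open>The Cayley transform centred at z0 carries the half-plane metric to that of the unit
  disk, so this is the disk identity for 1 - |(u - v) / (1 - u \<open>cnj v\<close>)|^2. The proof
  computes 1 - u \<open>cnj v\<close> explicitly.\<close>

lemma ph_defect_cayley:
  fixes z w z0 :: complex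
  assumes "0 < Im z" "0 < Im w" "0 < Im z0"
  defines "u \<equiv> (z - z0) / (z - cnj z0)" and "v \<equiv> (w - z0) / (w - cnj z0)"
  shows "ph_defect z w = (1 - (cmod u)\<^sup>2) * (1 - (cmod v)\<^sup>2) / (cmod (1 - u * cnj v))\<^sup>2"
proof -
  have nz: "z - cnj z0 \<noteq> 0" "w - cnj z0 \<noteq> 0" "cnj w - z0 \<noteq> 0" "z - cnj w \<noteq> 0" "z0 - cnj z0 \<noteq> 0"
    using assms(1-3) by (auto simp: complex_eq_iff)
  have "1 - u * cnj v = (z0 - cnj z0) * (z - cnj w) / ((z - cnj z0) * (z0 - cnj w))"
  proof -
    have "cnj v = (cnj w - cnj z0) / (cnj w - z0)" by (simp add: v_def)
    moreover have "z0 - cnj w \<noteq> 0" using nz(3) by auto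
    moreover have "1 - (z - z0) / (z - cnj z0) * ((cnj w - cnj z0) / (cnj w - z0)) =
      ((z - cnj z0) * (cnj w - z0) - (z - z0) * (cnj w - cnj z0)) / ((z - cnj z0) * (cnj w - z0))"
      using nz(1,3) by (simp only: times_divide_times_eq diff_divide_distrib[of "(z - cnj z0) * (cnj w - z0)"]) simp
    moreover have "(z - cnj z0) * (cnj w - z0) - (z - z0) * (cnj w - cnj z0) = - ((z0 - cnj z0) * (z - cnj w))"
      by (simp add: algebra_simps)
    moreover have "(z - cnj z0) * (cnj w - z0) = - ((z - cnj z0) * (z0 - cnj w))"
      by (simp add: algebra_simps)
    ultimately show ?thesis
      unfolding u_def by (simp only: minus_divide_left[symmetric] minus_divide_right[symmetric] minus_minus)
  qed
  then have 1: "(cmod (1 - u * cnj v))\<^sup>2 = 4 * (Im z0)\<^sup>2 * (cmod (z - cnj w))\<^sup>2 / ((cmod (z - cnj z0))\<^sup>2 * (cmod (z0 - cnj w))\<^sup>2)"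
  proof -
    have "(cmod (z0 - cnj z0))\<^sup>2 = 4 * (Im z0)\<^sup>2"
      using norm_diff_cnj_sq[of z0 z0] by (simp add: power2_eq_square)
    then show ?thesis
      unfolding \<open>1 - u * cnj v = _\<close> by (simp add: norm_mult norm_divide power_mult_distrib power_divide)
  qed
  have "cmod (w - cnj z0) = cmod (z0 - cnj w)"
    by (metis complex_cnj_cnj complex_cnj_diff complex_mod_cnj norm_minus_commute)
  moreover have nz': "0 < cmod (z - cnj z0)" "0 < cmod (z0 - cnj w)" "0 < cmod (z - cnj w)"
    using nz by (metis eq_iff_diff_eq_0 zero_less_norm_iff)+
  moreover have "1 - (cmod u)\<^sup>2 = ph_defect z z0" "1 - (cmod v)\<^sup>2 = ph_defect w z0"
    unfolding u_def v_def using ph_defect_eq assms(1-3) by simp_all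
  ultimately have "(1 - (cmod u)\<^sup>2) * (1 - (cmod v)\<^sup>2) / (cmod (1 - u * cnj v))\<^sup>2 =
      (4 * Im z * Im z0 / (cmod (z - cnj z0))\<^sup>2) * (4 * Im w * Im z0 / (cmod (z0 - cnj w))\<^sup>2) /
      (4 * (Im z0)\<^sup>2 * (cmod (z - cnj w))\<^sup>2 / ((cmod (z - cnj z0))\<^sup>2 * (cmod (z0 - cnj w))\<^sup>2))"
    by (simp only: 1 ph_defect_def)
  also have "\<dots> = ph_defect z w"
    using nz' assms(3) by (simp add: ph_defect_def field_simps power2_eq_square)
  finally show ?thesis by simp
qed

section \<open>Equally spaced points on a pseudohyperbolic circle\<close>

text \<open>Midpoints of the N arcs starting at angle 0 are used because these arcs partition [0, 2
  \<pi>) exactly; no arc wraps around 0.\<close>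

lemma nearest_midpoint_angle:
  assumes "0 < N" "0 \<le> \<theta>" "\<theta> < 2 * pi"
  obtains j \<phi> where "j < N" "\<bar>\<phi>\<bar> \<le> pi / real N" "\<theta> = 2 * pi * (real j + 1/2) / real N + \<phi>"
proof -
  define j where "j = nat \<lfloor>\<theta> * real N / (2 * pi)\<rfloor>"
  define y where "y = \<theta> * real N / (2 * pi)"
  have y: "0 \<le> y" "y < real N" using assms by (simp_all add: y_def field_simps)
  have j: "real j \<le> y" "y < real j + 1" using y(1) unfolding j_def y_def[symmetric] by linarith+
  then have "j < N" using y by linarith
  have th: "\<theta> = 2 * pi * y / real N" using assms by (simp add: y_def)
  show thesis
  proof (rule that[of j "2 * pi * (y - (real j + 1/2)) / real N"])
    have "\<bar>2 * (y - (real j + 1/2))\<bar> \<le> 1" using j by (simp add: abs_le_iff)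
    then have "\<bar>2 * (y - (real j + 1/2))\<bar> * (pi / real N) \<le> 1 * (pi / real N)"
      by (intro mult_right_mono) auto
    moreover have "2 * pi * (y - (real j + 1/2)) / real N = 2 * (y - (real j + 1/2)) * (pi / real N)"
      by simp
    ultimately show "\<bar>2 * pi * (y - (real j + 1/2)) / real N\<bar> \<le> pi / real N"
      by (simp only: abs_mult[of _ "pi / real N"]) simp
    show "\<theta> = 2 * pi * (real j + 1/2) / real N + 2 * pi * (y - (real j + 1/2)) / real N"
      unfolding th by (simp add: add_divide_distrib[symmetric] flip: distrib_left)
  qed fact
qed

text \<open>The left side equals (1 - q)^2 + 2 q (1 - cos \<phi>), and 2 (1 - cos \<phi>) is at most
  \<phi>^2.\<close>

lemma norm_one_minus_rcis_le:
  assumes "0 \<le> q" "q \<le> 1"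
  shows "(cmod (1 - of_real q * cis \<phi>))\<^sup>2 \<le> (1 - q)\<^sup>2 + \<phi>\<^sup>2"
proof -
  have "(cmod (1 - of_real q * cis \<phi>))\<^sup>2 = (1 - q)\<^sup>2 + 2 * q * (1 - cos \<phi>)"
    using sin_cos_squared_add[of \<phi>] unfolding cmod_power2
    by (simp add: power2_eq_square) algebra
  also have "2 * q * (1 - cos \<phi>) = q * (2 * (1 - cos \<phi>))" by simp
  also have "\<dots> \<le> 1 * \<phi>\<^sup>2"
  proof (intro mult_mono)
    have "1 - cos \<phi> = 2 * (sin (\<phi>/2))\<^sup>2" using cos_double_sin[of "\<phi>/2"] by simp
    moreover have "(sin (\<phi>/2))\<^sup>2 \<le> (\<phi>/2)\<^sup>2"
      using abs_sin_x_le_abs_x[of "\<phi>/2"] by (metis abs_le_square_iff)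
    ultimately show "2 * (1 - cos \<phi>) \<le> \<phi>\<^sup>2" by (simp add: power_divide)
  qed (use assms in auto)
  finally show ?thesis by simp
qed

text \<open>The preimages of equally spaced points \<open>v\<close> of modulus \<open>r\<close> under the Cayley transform
  \<open>z \<mapsto> (z - z0) / (z - cnj z0)\<close>.\<close>

definition circle_pt :: "complex \<Rightarrow> real \<Rightarrow> nat \<Rightarrow> nat \<Rightarrow> complex" where
  "circle_pt z0 r N j = (let v = of_real r * cis (2 * pi * (real j + 1/2) / real N) in (z0 - v * cnj z0) / (1 - v))"

text \<open>Solving (w - z0) / (w - \<open>cnj z0\<close>) = v for w gives \<open>circle_pt\<close>,
  with imaginary part Im z0 (1 - |v|^2) / |1 - v|^2.\<close>

lemma circle_pt:
  assumes "0 < Im z0" "0 \<le> r" "r < 1"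
  shows "0 < Im (circle_pt z0 r N j)"
    and "(circle_pt z0 r N j - z0) / (circle_pt z0 r N j - cnj z0) = of_real r * cis (2 * pi * (real j + 1/2) / real N)"
proof -
  define v where "v = of_real r * cis (2 * pi * (real j + 1/2) / real N)"
  have v: "cmod v < 1" using assms by (simp add: v_def norm_mult)
  then have v1: "1 - v \<noteq> 0" by auto
  have w: "circle_pt z0 r N j = (z0 - v * cnj z0) / (1 - v)"
    by (simp add: circle_pt_def v_def Let_def)
  have z0: "z0 - cnj z0 \<noteq> 0" using assms by (auto simp: complex_eq_iff)
  have 1: "circle_pt z0 r N j - z0 = v * (z0 - cnj z0) / (1 - v)"
    and 2: "circle_pt z0 r N j - cnj z0 = (z0 - cnj z0) / (1 - v)"
    unfolding w using v1 by (simp_all add: field_simps)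
  show "(circle_pt z0 r N j - z0) / (circle_pt z0 r N j - cnj z0) = of_real r * cis (2 * pi * (real j + 1/2) / real N)"
    unfolding 1 2 v_def[symmetric] using v1 z0 by simp
  have "Im ((z0 - v * cnj z0) / (1 - v)) = Im ((z0 - v * cnj z0) * cnj (1 - v)) / (cmod (1 - v))\<^sup>2"
    by (simp add: complex_div_cnj[of _ "1 - v"] del: complex_cnj_diff)
  also have "Im ((z0 - v * cnj z0) * cnj (1 - v)) = Im z0 * (1 - (cmod v)\<^sup>2)"
    unfolding cmod_power2 by (simp add: power2_eq_square algebra_simps)
  finally show "0 < Im (circle_pt z0 r N j)"
    unfolding w using assms v v1 by (simp add: power_less_one_iff abs_square_less_1)
qed

text \<open>In Cayley coordinates z becomes u of modulus s, and v of modulus r \<le> s is the point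
  nearest in angle. The angular error is at most \<pi> / N \<le> 1 - r^2 and 1 - r s \<le> 1 - r^2,
  so |1 - u \<open>cnj v\<close>|^2 is at most 2 (1 - r^2)^2, which compares the defects. In the
  other direction |1 - u \<open>cnj v\<close>| is at least 1 - r s, so \<rho>(z, w) is at least (s -
  r) / (1 - r s).\<close>

lemma circle_pt_covers:
  assumes z: "0 < Im z" and z0: "0 < Im z0" and r: "0 \<le> r" "r < 1" and N: "pi / (1 - r\<^sup>2) \<le> real N"
    and R: "r \<le> cmod ((z - z0) / (z - cnj z0))"
    and d: "\<And>s. s < 1 \<Longrightarrow> cmod ((z - z0) / (z - cnj z0)) \<le> s \<Longrightarrow> d * (1 - r * s) \<le> s - r" "0 \<le> d"
  obtains j where "j < N" "ph_defect z z0 \<le> 2 * (1 - r\<^sup>2) * ph_defect z (circle_pt z0 r N j)"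
    "d \<le> cmod ((z - circle_pt z0 r N j) / (z - cnj (circle_pt z0 r N j)))"
proof -
  define u where "u = (z - z0) / (z - cnj z0)"
  define s where "s = cmod u"
  define \<theta> where "\<theta> = Arg2pi u"
  have r2: "0 < 1 - r\<^sup>2" using r by (simp add: abs_square_less_1)
  have "0 < N" using N r2 by (metis divide_pos_pos less_le_trans of_nat_0_less_iff pi_gt_zero)
  then obtain j \<phi> where j: "j < N" "\<bar>\<phi>\<bar> \<le> pi / real N" "\<theta> = 2 * pi * (real j + 1/2) / real N + \<phi>"
    using nearest_midpoint_angle Arg2pi_ge_0 Arg2pi_lt_2pi unfolding \<theta>_def by metis
  define w where "w = circle_pt z0 r N j"
  define v where "v = of_real r * cis (2 * pi * (real j + 1/2) / real N)"
  have w: "0 < Im w" "(w - z0) / (w - cnj z0) = v"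
    using circle_pt[OF z0 r] by (simp_all add: w_def v_def)
  have u: "u = of_real s * cis \<theta>"
    unfolding s_def \<theta>_def cis_conv_exp by (metis Arg2pi_eq mult.commute mult.assoc)
  have "1 - s\<^sup>2 = ph_defect z z0" using ph_defect_eq[OF z z0] by (simp add: s_def u_def)
  moreover have "0 < ph_defect z z0" by (rule ph_defect_pos[OF z z0])
  ultimately have s2: "ph_defect z z0 = 1 - s\<^sup>2" "s < 1" "0 \<le> s"
    using abs_square_less_1[of s] by (auto simp: s_def)
  have rs: "r \<le> s" using R by (simp add: s_def u_def)
  have kw: "ph_defect z w = (1 - s\<^sup>2) * (1 - r\<^sup>2) / (cmod (1 - u * cnj v))\<^sup>2"
  proof -
    have "cmod v = r" using r by (simp add: v_def norm_mult)
    then show ?thesis using ph_defect_cayley[OF z w(1) z0] w(2) by (simp add: u_def s_def)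
  qed
  have uv: "u * cnj v = of_real (r * s) * cis \<phi>"
    unfolding u v_def j(3) by (simp add: cis_cnj cis_mult flip: cis_mult cis_inverse)
  have q: "0 \<le> r * s" "r * s < 1" "r\<^sup>2 \<le> r * s"
    using r s2 rs mult_strict_mono'[of r 1 s 1] by (auto simp: power2_eq_square mult_left_mono)
  have "cmod (u * cnj v) = r * s" unfolding uv using q r s2 by (simp add: norm_mult)
  then have low: "1 - r * s \<le> cmod (1 - u * cnj v)"
    using norm_triangle_ineq2[of 1 "u * cnj v"] by simp
  have "pi / real N \<le> 1 - r\<^sup>2" using N r2 \<open>0 < N\<close> by (simp add: field_simps)
  then have "\<bar>\<phi>\<bar> \<le> 1 - r\<^sup>2" using j(2) by linarith
  then have "\<phi>\<^sup>2 \<le> (1 - r\<^sup>2)\<^sup>2" by (metis abs_ge_zero power2_abs power_mono)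
  moreover have "(1 - r * s)\<^sup>2 \<le> (1 - r\<^sup>2)\<^sup>2" using q by (intro power_mono) auto
  ultimately have up: "(cmod (1 - u * cnj v))\<^sup>2 \<le> 2 * (1 - r\<^sup>2)\<^sup>2"
    unfolding uv using norm_one_minus_rcis_le[of "r * s" \<phi>] q by linarith
  have pos: "0 < cmod (1 - u * cnj v)" using low q by linarith
  have s2p: "0 < 1 - s\<^sup>2" using s2 by (simp add: abs_square_less_1)
  show thesis
  proof (rule that[of j, OF j(1), folded w_def])
    have "(1 - s\<^sup>2) * (cmod (1 - u * cnj v))\<^sup>2 \<le> (1 - s\<^sup>2) * (2 * (1 - r\<^sup>2)\<^sup>2)"
      using up s2p by (intro mult_left_mono) auto
    then show "ph_defect z z0 \<le> 2 * (1 - r\<^sup>2) * ph_defect z w"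
      unfolding kw s2(1) using pos by (simp add: field_simps power2_eq_square)
    have "d\<^sup>2 \<le> (cmod ((z - w) / (z - cnj w)))\<^sup>2"
    proof -
      have "d \<le> (s - r) / (1 - r * s)"
        using d(1)[of s] s2 q by (simp add: s_def u_def field_simps)
      then have "d\<^sup>2 \<le> ((s - r) / (1 - r * s))\<^sup>2" using d(2) by (rule power_mono)
      \<comment> \<open>In this form only the denominator differs from 1 -
        \<open>ph_defect z w\<close>, and it grows when 1 - r s is replaced by |1 - u
        \<open>cnj v\<close>|.\<close>
      also have "\<dots> = 1 - (1 - s\<^sup>2) * (1 - r\<^sup>2) / (1 - r * s)\<^sup>2"
      proof -
        have "(s - r)\<^sup>2 = (1 - r * s)\<^sup>2 - (1 - s\<^sup>2) * (1 - r\<^sup>2)"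
          by (simp add: power2_eq_square algebra_simps)
        then have "((s - r) / (1 - r * s))\<^sup>2 = ((1 - r * s)\<^sup>2 - (1 - s\<^sup>2) * (1 - r\<^sup>2)) / (1 - r * s)\<^sup>2"
          by (simp only: power_divide)
        then show ?thesis using q by (simp add: diff_divide_distrib)
      qed
      also have "\<dots> \<le> 1 - (1 - s\<^sup>2) * (1 - r\<^sup>2) / (cmod (1 - u * cnj v))\<^sup>2"
        using low q s2p r2 pos by (intro diff_left_mono divide_left_mono power_mono mult_pos_pos mult_nonneg_nonneg) auto
      also have "\<dots> = (cmod ((z - w) / (z - cnj w)))\<^sup>2"
        using ph_defect_eq[OF z w(1)] kw by simp
      finally show ?thesis .
    qed
    then show "d \<le> cmod ((z - w) / (z - cnj w))"
      using power2_le_imp_le norm_ge_zero by blast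
  qed
qed

section \<open>Wavelet transforms of the test functions\<close>

text \<open>The coefficient of t^k in the polynomial \<open>laguerre n \<alpha> (2 * t)\<close>; the
  power of 2 absorbs the dilation in \<open>psi_hat\<close>.\<close>

definition laguerre_coeff :: "nat \<Rightarrow> real \<Rightarrow> nat \<Rightarrow> real" where
  "laguerre_coeff n \<alpha> k = (-1) ^ k / fact k * ((real n + \<alpha>) gchoose (n - k)) * 2 ^ k"

definition psi_norm :: "nat \<Rightarrow> real \<Rightarrow> real" where
  "psi_norm n \<alpha> = sqrt (2 powr (\<alpha> + 2) * pi * fact n / Gamma (real n + \<alpha> + 1))"

text \<open>Reduces integrals of the wavelet's Fourier transform to \<open>Gamma_Laplace\<close>,
  term by term. The factor exp(-x) inside \<open>psi_hat\<close> shifts the parameter r to 1 +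
  r.\<close>

lemma psi_hat_gamma_kernel:
  "of_real (psi_hat n \<alpha> x * x powr b) * exp (- (r * of_real x)) =
     (\<Sum>k=0..n. of_real (psi_norm n \<alpha> * laguerre_coeff n \<alpha> k) * gamma_kernel (\<alpha> / 2 + b + real k) (1 + r) x)"
proof (cases "0 < x")
  case True
  have "of_real (psi_hat n \<alpha> x * x powr b) * exp (- (r * of_real x)) =
    of_real (psi_norm n \<alpha>) * of_real (x powr (\<alpha> / 2 + b)) * (exp (- of_real x) * exp (- (r * of_real x))) * of_real (laguerre n \<alpha> (2 * x))"
    using True by (simp add: psi_hat_def psi_norm_def powr_add exp_of_real[symmetric])
  also have "exp (- of_real x) * exp (- (r * of_real x)) = exp (- ((1 + r) * of_real x))"
    by (simp add: exp_add[symmetric] algebra_simps)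
  also have "of_real (laguerre n \<alpha> (2 * x)) = (\<Sum>k=0..n. complex_of_real (laguerre_coeff n \<alpha> k * x ^ k))"
    by (simp add: laguerre_def laguerre_coeff_def power_mult_distrib mult.assoc)
  also have "of_real (psi_norm n \<alpha>) * of_real (x powr (\<alpha> / 2 + b)) * exp (- ((1 + r) * of_real x)) * (\<Sum>k=0..n. complex_of_real (laguerre_coeff n \<alpha> k * x ^ k))
    = (\<Sum>k=0..n. of_real (psi_norm n \<alpha> * laguerre_coeff n \<alpha> k) * gamma_kernel (\<alpha> / 2 + b + real k) (1 + r) x)"
    unfolding sum_distrib_left
    by (rule sum.cong) (use True in \<open>simp_all add: gamma_kernel_def powr_add powr_realpow\<close>)
  finally show ?thesis .
qed (simp add: psi_hat_def gamma_kernel_def)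

text \<open>The Gamma value produced by the Laplace transform of the k-th term cancels the one in
  the generalized binomial coefficient. What remains is an ordinary binomial coefficient, ready for
  the binomial theorem.\<close>

lemma laguerre_coeff_Gamma:
  assumes "0 < \<alpha>" "k \<le> n"
  shows "laguerre_coeff n \<alpha> k * Gamma (\<alpha> + real k + 1) = Gamma (real n + \<alpha> + 1) / fact n * (real (n choose k) * (-2) ^ k)"
proof -
  have "((real n + \<alpha>) gchoose (n - k)) = Gamma (real n + \<alpha> + 1) / (fact (n - k) * Gamma (real n + \<alpha> - real (n - k) + 1))"
    using assms by (intro gbinomial_Gamma) (auto elim!: nonpos_Ints_cases)
  also have "real n + \<alpha> - real (n - k) + 1 = \<alpha> + real k + 1"
    using assms by (simp add: of_nat_diff)
  finally have g: "((real n + \<alpha>) gchoose (n - k)) = Gamma (real n + \<alpha> + 1) / (fact (n - k) * Gamma (\<alpha> + real k + 1))" .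
  have "0 < Gamma (\<alpha> + real k + 1)" using assms by (intro Gamma_real_pos) auto
  moreover have "real (n choose k) = fact n / (fact k * fact (n - k))"
    using assms by (intro binomial_fact)
  moreover have "(-2::real) ^ k = (-1) ^ k * 2 ^ k" by (simp flip: power_mult_distrib)
  ultimately show ?thesis
    unfolding laguerre_coeff_def g by (simp add: field_simps)
qed

text \<open>Termwise \<open>Gamma_Laplace\<close> yields q^(-(\<alpha>+1)) times the binomial
  expansion of (1 - 2/q)^n. This power of n later becomes the factor \<rho>^n.\<close>

lemma laguerre_laplace:
  assumes \<alpha>: "0 < \<alpha>" and q: "0 < Re q"
  shows "(\<integral>x. of_real (psi_hat n \<alpha> x * x powr (\<alpha> / 2)) * exp (- ((q - 1) * of_real x)) \<partial>lborel) =
     of_real (psi_norm n \<alpha> * Gamma (real n + \<alpha> + 1) / fact n) * q powr (- of_real (\<alpha> + 1)) * (1 - 2 / q) ^ n"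
proof -
  have q0: "q \<noteq> 0" using q by auto
  have "(\<integral>x. of_real (psi_hat n \<alpha> x * x powr (\<alpha> / 2)) * exp (- ((q - 1) * of_real x)) \<partial>lborel)
     = (\<integral>x. (\<Sum>k=0..n. of_real (psi_norm n \<alpha> * laguerre_coeff n \<alpha> k) * gamma_kernel (\<alpha> + real k) q x) \<partial>lborel)"
    unfolding psi_hat_gamma_kernel by simp
  also have "\<dots> = (\<Sum>k=0..n. of_real (psi_norm n \<alpha> * laguerre_coeff n \<alpha> k) * (\<integral>x. gamma_kernel (\<alpha> + real k) q x \<partial>lborel))"
    using \<alpha> q by (subst Bochner_Integration.integral_sum) (auto intro!: integrable_mult_right integrable_gamma_kernel)
  also have "\<dots> = (\<Sum>k=0..n. of_real (psi_norm n \<alpha> * Gamma (real n + \<alpha> + 1) / fact n) * q powr (- of_real (\<alpha> + 1)) * (of_nat (n choose k) * (- (2 / q)) ^ k * 1 ^ (n - k)))"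
  proof (rule sum.cong)
    fix k assume k: "k \<in> {0..n}"
    have "q powr (- of_real (\<alpha> + real k + 1)) = q powr (- of_real (\<alpha> + 1) - of_nat k)"
      by (rule arg_cong[where f = "(powr) q"]) simp
    also have "\<dots> = q powr (- of_real (\<alpha> + 1)) / q ^ k"
      using q0 by (simp add: powr_diff)
    finally have 1: "q powr (- of_real (\<alpha> + real k + 1)) = q powr (- of_real (\<alpha> + 1)) / q ^ k" .
    have "of_real (psi_norm n \<alpha> * laguerre_coeff n \<alpha> k) * (\<integral>x. gamma_kernel (\<alpha> + real k) q x \<partial>lborel)
      = of_real (psi_norm n \<alpha> * (laguerre_coeff n \<alpha> k * Gamma (\<alpha> + real k + 1))) * q powr (- of_real (\<alpha> + real k + 1))"
      using \<alpha> q by (subst Gamma_Laplace) auto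
    also have "laguerre_coeff n \<alpha> k * Gamma (\<alpha> + real k + 1) = Gamma (real n + \<alpha> + 1) / fact n * (real (n choose k) * (-2) ^ k)"
      using \<alpha> k by (intro laguerre_coeff_Gamma) auto
    finally show "of_real (psi_norm n \<alpha> * laguerre_coeff n \<alpha> k) * (\<integral>x. gamma_kernel (\<alpha> + real k) q x \<partial>lborel) =
      of_real (psi_norm n \<alpha> * Gamma (real n + \<alpha> + 1) / fact n) * q powr (- of_real (\<alpha> + 1)) * (of_nat (n choose k) * (- (2 / q)) ^ k * 1 ^ (n - k))"
      unfolding 1 minus_divide_left power_divide by simp
  qed simp
  also have "\<dots> = of_real (psi_norm n \<alpha> * Gamma (real n + \<alpha> + 1) / fact n) * q powr (- of_real (\<alpha> + 1)) * (- (2 / q) + 1) ^ n"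
    unfolding binomial_ring[of "- (2 / q)" 1 n] sum_distrib_left by (simp add: atLeast0AtMost)
  finally show ?thesis by simp
qed

lemma laguerre_measurable [measurable]: "laguerre n \<alpha> \<in> borel_measurable borel"
  unfolding laguerre_def[abs_def] by measurable

lemma psi_hat_measurable [measurable]: "psi_hat n \<alpha> \<in> borel_measurable borel"
  unfolding psi_hat_def[abs_def] by measurable

lemma integrable_psi_hat:
  assumes "0 < \<alpha>"
  shows "integrable lborel (\<lambda>x. complex_of_real (psi_hat n \<alpha> x))"
proof -
  \<comment> \<open>The case b = 0, r = 0. The value \<open>0 powr 0 = 0\<close> is harmless because
    \<open>psi_hat\<close> vanishes at 0.\<close>
  have "complex_of_real (psi_hat n \<alpha> x) = (\<Sum>k=0..n. of_real (psi_norm n \<alpha> * laguerre_coeff n \<alpha> k) * gamma_kernel (\<alpha> / 2 + real k) 1 x)" for x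
    using psi_hat_gamma_kernel[of n \<alpha> x 0 0] by (cases "0 < x") (auto simp: psi_hat_def)
  then show ?thesis
    using assms by (auto intro!: Bochner_Integration.integrable_sum integrable_mult_right integrable_gamma_kernel)
qed

text \<open>Up to a factor independent of \<open>w\<close>, this is the time-scale shift of \<open>\<psi>\<^sub>0\<close> by \<open>w\<close>.\<close>

definition test_fn :: "real \<Rightarrow> complex \<Rightarrow> complex \<Rightarrow> complex" where
  "test_fn \<alpha> w t = of_real (Im w powr ((\<alpha> + 1) / 2)) * (- (\<i> * (t - cnj w))) powr (- of_real (\<alpha> / 2 + 1))"

lemma test_fn_line:
  "test_fn \<alpha> w (of_real t + \<i> * of_real s) =
     of_real (Im w powr ((\<alpha> + 1) / 2)) * (Complex (s + Im w) (Re w) - \<i> * of_real t) powr (- of_real (\<alpha> / 2 + 1))"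
proof -
  have "- (\<i> * (of_real t + \<i> * of_real s - cnj w)) = Complex (s + Im w) (Re w) - \<i> * of_real t"
    by (simp add: complex_eq_iff)
  then show ?thesis by (simp only: test_fn_def)
qed

section \<open>Hardy norms of the test functions\<close>

text \<open>The squared norm shared by all test functions (\<open>hardy2_test_fn\<close>). It is
  left unevaluated, since it is finite and positive and cancels from the sampling bounds.\<close>

definition line_norm :: "real \<Rightarrow> real" where
  "line_norm \<alpha> = (\<integral>t. cmod (1 - \<i> * of_real t) powr (- (\<alpha> + 2)) \<partial>lborel)"

lemma line_norm:
  assumes "0 < \<alpha>"
  shows "(\<integral>\<^sup>+t. ennreal (cmod (1 - \<i> * of_real t) powr (- (\<alpha> + 2))) \<partial>lborel) = ennreal (line_norm \<alpha>)"
    and "0 < line_norm \<alpha>"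
proof -
  have i: "integrable lborel (\<lambda>t. cmod (1 - \<i> * of_real t) powr (- (\<alpha> + 2)))"
    using assms by (intro integrable_vertical_line_powr) auto
  then show 1: "(\<integral>\<^sup>+t. ennreal (cmod (1 - \<i> * of_real t) powr (- (\<alpha> + 2))) \<partial>lborel) = ennreal (line_norm \<alpha>)"
    unfolding line_norm_def by (intro nn_integral_eq_integral) auto
  have pos: "0 < cmod (1 - \<i> * of_real t) powr (- (\<alpha> + 2))" for t
    by (auto simp: complex_eq_iff)
  have "(\<integral>\<^sup>+t. ennreal (cmod (1 - \<i> * of_real t) powr (- (\<alpha> + 2))) \<partial>lborel) \<noteq> 0"
  proof
    assume "(\<integral>\<^sup>+t. ennreal (cmod (1 - \<i> * of_real t) powr (- (\<alpha> + 2))) \<partial>lborel) = 0"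
    then have "AE t in lborel. ennreal (cmod (1 - \<i> * of_real t) powr (- (\<alpha> + 2))) = 0"
      by (subst (asm) nn_integral_0_iff_AE) auto
    then have "AE t in (lborel :: real measure). False"
      using pos by (simp add: ennreal_eq_0_iff not_le)
    then have "emeasure lborel (UNIV :: real set) = 0"
      by (simp add: AE_iff_null null_sets_def)
    then show False by simp
  qed
  then show "0 < line_norm \<alpha>" unfolding 1 by (simp add: ennreal_eq_0_iff not_le)
qed

text \<open>The substitution of Re w + a t for t with a = s + Im w reduces every line to the one
  defining \<open>line_norm\<close>, and the powers of a combine to a^(-(\<alpha>+1)).\<close>

lemma nn_integral_test_fn:
  assumes \<alpha>: "0 < \<alpha>" and w: "0 < Im w" and s: "0 < s"
  shows "(\<integral>\<^sup>+t. ennreal ((cmod (test_fn \<alpha> w (of_real t + \<i> * of_real s)))\<^sup>2) \<partial>lborel) =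
    ennreal ((Im w / (s + Im w)) powr (\<alpha> + 1) * line_norm \<alpha>)"
proof -
  define a where "a = s + Im w"
  have a: "0 < a" using w s by (simp add: a_def)
  have sq: "(cmod (test_fn \<alpha> w (of_real t + \<i> * of_real s)))\<^sup>2 =
     Im w powr (\<alpha> + 1) * cmod (Complex a (Re w) - \<i> * of_real t) powr (- (\<alpha> + 2))" for t
  proof -
    have "cmod (Complex a (Re w) - \<i> * of_real t) \<noteq> 0"
      using a by (auto simp: complex_eq_iff)
    then have "cmod (test_fn \<alpha> w (of_real t + \<i> * of_real s)) =
      Im w powr ((\<alpha> + 1) / 2) * cmod (Complex a (Re w) - \<i> * of_real t) powr (- (\<alpha> / 2 + 1))"
      unfolding test_fn_line a_def[symmetric] norm_mult by (subst norm_powr_real_powr') auto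
    moreover have "(x powr y)\<^sup>2 = x powr (2 * y)" for x y :: real
      by (simp add: power2_eq_square flip: powr_add)
    moreover have "2 * ((\<alpha> + 1) / 2) = \<alpha> + 1" "2 * - (\<alpha> / 2 + 1) = - (\<alpha> + 2)" by simp_all
    ultimately show ?thesis by (simp only: power_mult_distrib)
  qed
  have sc: "cmod (Complex a (Re w) - \<i> * of_real (Re w + a * t)) powr (- (\<alpha> + 2)) = a powr (- (\<alpha> + 2)) * cmod (1 - \<i> * of_real t) powr (- (\<alpha> + 2))" for t
  proof -
    have "Complex a (Re w) - \<i> * of_real (Re w + a * t) = of_real a * (1 - \<i> * of_real t)"
      by (simp add: complex_eq_iff)
    then show ?thesis using a by (simp add: norm_mult powr_mult)
  qed
  have "(\<integral>\<^sup>+t. ennreal ((cmod (test_fn \<alpha> w (of_real t + \<i> * of_real s)))\<^sup>2) \<partial>lborel) =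
    (\<integral>\<^sup>+t. ennreal (Im w powr (\<alpha> + 1) * cmod (Complex a (Re w) - \<i> * of_real t) powr (- (\<alpha> + 2))) \<partial>lborel)"
    unfolding sq ..
  also have "\<dots> = ennreal \<bar>a\<bar> * (\<integral>\<^sup>+t. ennreal (Im w powr (\<alpha> + 1) * cmod (Complex a (Re w) - \<i> * of_real (Re w + a * t)) powr (- (\<alpha> + 2))) \<partial>lborel)"
    using a by (intro nn_integral_real_affine) auto
  also have "\<dots> = ennreal a * (\<integral>\<^sup>+t. ennreal (Im w powr (\<alpha> + 1) * a powr (- (\<alpha> + 2))) * ennreal (cmod (1 - \<i> * of_real t) powr (- (\<alpha> + 2))) \<partial>lborel)"
    using a unfolding sc by (simp add: mult.assoc flip: ennreal_mult)
  also have "\<dots> = ennreal a * (ennreal (Im w powr (\<alpha> + 1) * a powr (- (\<alpha> + 2))) * ennreal (line_norm \<alpha>))"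
    by (subst nn_integral_cmult) (simp_all only: line_norm(1)[OF \<alpha>], measurable)
  also have "\<dots> = ennreal (a * (Im w powr (\<alpha> + 1) * a powr (- (\<alpha> + 2)) * line_norm \<alpha>))"
    using a line_norm(2)[OF \<alpha>] by (simp add: ennreal_mult)
  also have "a * (Im w powr (\<alpha> + 1) * a powr (- (\<alpha> + 2)) * line_norm \<alpha>) = Im w powr (\<alpha> + 1) * (a * a powr (- (\<alpha> + 2))) * line_norm \<alpha>"
    by simp
  also have "a * a powr (- (\<alpha> + 2)) = a powr (- (\<alpha> + 1))"
  proof -
    have "a * a powr (- (\<alpha> + 2)) = a powr (1 + - (\<alpha> + 2))"
      using a by (intro powr_mult_base) simp
    also have "1 + - (\<alpha> + 2) = - (\<alpha> + 1)" by simp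
    finally show ?thesis .
  qed
  also have "Im w powr (\<alpha> + 1) * a powr (- (\<alpha> + 1)) = (Im w / a) powr (\<alpha> + 1)"
    by (simp only: powr_divide powr_minus) (simp only: divide_inverse)
  finally show ?thesis by (simp add: a_def)
qed

text \<open>The line integrals of \<open>nn_integral_test_fn\<close> stay below
  \<open>line_norm \<alpha>\<close> and tend to it as s tends to 0 from above, so the supremum does
  not depend on w.\<close>

lemma hardy2_test_fn:
  assumes \<alpha>: "0 < \<alpha>" and w: "0 < Im w"
  shows "hardy2 (test_fn \<alpha> w)" and "hardy2_norm_sq (test_fn \<alpha> w) = line_norm \<alpha>"
proof -
  have "hardy2_sup (test_fn \<alpha> w) = (SUP s\<in>{0<..}. ennreal ((Im w / (s + Im w)) powr (\<alpha> + 1) * line_norm \<alpha>))"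
    unfolding hardy2_sup_def using nn_integral_test_fn[OF \<alpha> w] by (intro SUP_cong) auto
  also have "\<dots> = ennreal (line_norm \<alpha>)"
  proof (rule SUP_eqI)
    fix s :: real assume "s \<in> {0<..}"
    then have "(Im w / (s + Im w)) powr (\<alpha> + 1) \<le> 1 powr (\<alpha> + 1)"
      using w \<alpha> by (intro powr_mono2) auto
    then show "ennreal ((Im w / (s + Im w)) powr (\<alpha> + 1) * line_norm \<alpha>) \<le> ennreal (line_norm \<alpha>)"
      using line_norm(2)[OF \<alpha>] by (intro ennreal_leI) (simp add: mult_left_le_one_le)
  next
    fix u assume u: "\<And>s. s \<in> {0<..} \<Longrightarrow> ennreal ((Im w / (s + Im w)) powr (\<alpha> + 1) * line_norm \<alpha>) \<le> u"
    have "((\<lambda>s. ennreal ((Im w / (s + Im w)) powr (\<alpha> + 1) * line_norm \<alpha>)) \<longlongrightarrow>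
        ennreal ((Im w / (0 + Im w)) powr (\<alpha> + 1) * line_norm \<alpha>)) (at_right 0)"
      using w by (intro tendsto_intros tendsto_ennrealI) auto
    then have "((\<lambda>s. ennreal ((Im w / (s + Im w)) powr (\<alpha> + 1) * line_norm \<alpha>)) \<longlongrightarrow> ennreal (line_norm \<alpha>)) (at_right 0)"
      using w by simp
    moreover have "\<forall>\<^sub>F s in at_right 0. ennreal ((Im w / (s + Im w)) powr (\<alpha> + 1) * line_norm \<alpha>) \<le> u"
      using eventually_at_right_less[of "0::real"] by eventually_elim (use u in auto)
    ultimately show "ennreal (line_norm \<alpha>) \<le> u"
      by (rule tendsto_upperbound) simp
  qed
  finally have sup: "hardy2_sup (test_fn \<alpha> w) = ennreal (line_norm \<alpha>)" .
  then show "hardy2_norm_sq (test_fn \<alpha> w) = line_norm \<alpha>"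
    using line_norm(2)[OF \<alpha>] by (simp add: hardy2_norm_sq_def)
  have "test_fn \<alpha> w holomorphic_on upper_half"
    unfolding test_fn_def[abs_def] using w
    by (intro holomorphic_intros) (auto simp: upper_half_def complex_nonpos_Reals_iff)
  then show "hardy2 (test_fn \<alpha> w)" using sup by (simp add: hardy2_def)
qed

section \<open>The wavelet transform as a kernel in the pseudohyperbolic distance\<close>

lemma integrable_pair_mult:
  fixes f g :: "real \<Rightarrow> complex"
  assumes "integrable lborel f" "integrable lborel g"
  shows "integrable (lborel \<Otimes>\<^sub>M lborel) (\<lambda>(x, y). f x * g y)"
proof (rule lborel_pair.Fubini_integrable)
  have [measurable]: "f \<in> borel_measurable borel" "g \<in> borel_measurable borel"
    using assms by (auto dest: borel_measurable_integrable)
  show "(\<lambda>(x, y). f x * g y) \<in> borel_measurable (lborel \<Otimes>\<^sub>M lborel)" by measurable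
qed (use assms in \<open>auto simp: norm_mult\<close>)

text \<open>At positive height s the wavelet is an absolutely convergent Fourier integral. Fubini
  moves the t-integral inside, where it is the Fourier transform of a power, and the remaining
  \<xi>-integral is \<open>laguerre_laplace\<close> at q. The constant C is a parameter so that it
  is the same for all w, z and s.\<close>

lemma wavelet_line_integral:
  assumes \<alpha>: "0 < \<alpha>" and w: "0 < Im w" and z: "0 < Im z" and s: "0 < s"
    and C: "\<And>a \<xi>. 0 < Re a \<Longrightarrow> 0 < \<xi> \<Longrightarrow>
     (\<integral>t. (a - \<i> * of_real t) powr (- of_real (\<alpha> / 2 + 1)) * exp (- (\<i> * of_real t * of_real \<xi>)) \<partial>lborel)
       = C * of_real (\<xi> powr (\<alpha> / 2)) * exp (- (a * of_real \<xi>))"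
  defines "q \<equiv> (2 * of_real s - \<i> * (z - cnj w)) / of_real (Im z)"
  shows "(\<integral>t. test_fn \<alpha> w (of_real t + \<i> * of_real s) * cnj (time_scale_shift z (psi n \<alpha>) (of_real t + \<i> * of_real s)) \<partial>lborel) =
    of_real (Im w powr ((\<alpha> + 1) / 2) * Im z powr (-1/2) * Im z powr (- \<alpha> / 2) / (2 * pi)
       * psi_norm n \<alpha> * Gamma (real n + \<alpha> + 1) / fact n) * C * q powr (- of_real (\<alpha> + 1)) * (1 - 2 / q) ^ n"
proof -
  define a where "a = Complex (s + Im w) (Re w)"
  define p where "p = - complex_of_real (\<alpha> / 2 + 1)"
  define \<eta> where "\<eta> = Im z"
  define K where "K = complex_of_real (Im w powr ((\<alpha> + 1) / 2) * \<eta> powr (-1/2) / (2 * pi))"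
  define h where "h \<xi> = complex_of_real (psi_hat n \<alpha> \<xi>)" for \<xi>
  \<comment> \<open>The conjugated exponential of the wavelet splits into \<open>E1\<close>, free of
    t and of modulus at most 1 for \<xi> > 0, and the oscillation \<open>E2\<close> at frequency
    \<xi> / \<eta>, to which the hypothesis on C applies.\<close>
  define E1 where "E1 \<xi> = exp (- ((of_real s - \<i> * of_real (Re z)) / of_real \<eta> * of_real \<xi>))" for \<xi>
  define E2 where "E2 t \<xi> = exp (- (\<i> * of_real t * of_real (\<xi> / \<eta>)))" for t \<xi>
  have \<eta>: "0 < \<eta>" using z by (simp add: \<eta>_def)
  have a: "0 < Re a" using w s by (simp add: a_def)
  have [measurable]: "h \<in> borel_measurable borel" unfolding h_def by measurable
  have h0: "h \<xi> = 0" if "\<xi> \<le> 0" for \<xi> using that by (simp add: h_def psi_hat_def)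
  have cnj_shift: "cnj (time_scale_shift z (psi n \<alpha>) (of_real t + \<i> * of_real s)) =
     of_real (\<eta> powr (-1/2) / (2 * pi)) * (\<integral>\<xi>. h \<xi> * E1 \<xi> * E2 t \<xi> \<partial>lborel)" for t
  proof -
    define v where "v = (of_real t + \<i> * of_real s - of_real (Re z)) / complex_of_real \<eta>"
    have "psi n \<alpha> v = of_real (1 / (2 * pi)) * (\<integral>\<xi>. h \<xi> * exp (\<i> * v * of_real \<xi>) \<partial>lborel)"
      unfolding psi_def set_lebesgue_integral_def h_def
      by (intro arg_cong2[where f = "(*)"] Bochner_Integration.integral_cong) (auto simp: indicator_def psi_hat_def)
    then have "cnj (psi n \<alpha> v) = of_real (1 / (2 * pi)) * (\<integral>\<xi>. cnj (h \<xi> * exp (\<i> * v * of_real \<xi>)) \<partial>lborel)"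
      by (subst Bochner_Integration.integral_cnj) simp
    also have "(\<lambda>\<xi>. cnj (h \<xi> * exp (\<i> * v * of_real \<xi>))) = (\<lambda>\<xi>. h \<xi> * E1 \<xi> * E2 t \<xi>)"
    proof
      fix \<xi> :: real
      have "cnj (\<i> * v * of_real \<xi>) = - ((of_real s - \<i> * of_real (Re z)) / of_real \<eta> * of_real \<xi>) + - (\<i> * of_real t * of_real (\<xi> / \<eta>))"
        using \<eta> by (simp add: v_def field_simps)
      then have "cnj (exp (\<i> * v * of_real \<xi>)) = E1 \<xi> * E2 t \<xi>"
        unfolding E1_def E2_def exp_add[symmetric] by (simp only: exp_cnj)
      then show "cnj (h \<xi> * exp (\<i> * v * of_real \<xi>)) = h \<xi> * E1 \<xi> * E2 t \<xi>"
        by (simp add: h_def)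
    qed
    finally show ?thesis
      by (simp add: time_scale_shift_def v_def \<eta>_def)
  qed
  have "(\<integral>t. test_fn \<alpha> w (of_real t + \<i> * of_real s) * cnj (time_scale_shift z (psi n \<alpha>) (of_real t + \<i> * of_real s)) \<partial>lborel)
    = (\<integral>t. K * (\<integral>\<xi>. (a - \<i> * of_real t) powr p * h \<xi> * E1 \<xi> * E2 t \<xi> \<partial>lborel) \<partial>lborel)"
    unfolding cnj_shift test_fn_line a_def[symmetric] p_def[symmetric] K_def
    by (intro Bochner_Integration.integral_cong) (simp_all add: mult.assoc)
  also have "\<dots> = K * (\<integral>t. (\<integral>\<xi>. (a - \<i> * of_real t) powr p * h \<xi> * E1 \<xi> * E2 t \<xi> \<partial>lborel) \<partial>lborel)"
    by simp
  also have "(\<integral>t. (\<integral>\<xi>. (a - \<i> * of_real t) powr p * h \<xi> * E1 \<xi> * E2 t \<xi> \<partial>lborel) \<partial>lborel) =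
     (\<integral>\<xi>. (\<integral>t. (a - \<i> * of_real t) powr p * h \<xi> * E1 \<xi> * E2 t \<xi> \<partial>lborel) \<partial>lborel)"
  \<comment> \<open>The integrand is dominated by a product of a function of t, integrable because
    \<alpha> / 2 + 1 > 1, and the integrable \<open>h\<close>.\<close>
  proof (rule lborel_pair.Fubini_integral[symmetric])
    have int1: "integrable lborel (\<lambda>t. (a - \<i> * of_real t) powr p)"
    proof (rule Bochner_Integration.integrable_bound)
      show "integrable lborel (\<lambda>t. cmod (a - \<i> * of_real t) powr (- (\<alpha> / 2 + 1)))"
        using a \<alpha> by (intro integrable_vertical_line_powr) auto
      show "AE t in lborel. norm ((a - \<i> * of_real t) powr p) \<le> norm (cmod (a - \<i> * of_real t) powr (- (\<alpha> / 2 + 1)))"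
        unfolding p_def by (subst norm_powr_real_powr') auto
    qed (auto simp: p_def)
    show "integrable (lborel \<Otimes>\<^sub>M lborel) (\<lambda>(t, \<xi>). (a - \<i> * of_real t) powr p * h \<xi> * E1 \<xi> * E2 t \<xi>)"
    proof (rule Bochner_Integration.integrable_bound)
      show "integrable (lborel \<Otimes>\<^sub>M lborel) (\<lambda>(t, \<xi>). (a - \<i> * of_real t) powr p * h \<xi>)"
        using int1 integrable_psi_hat[OF \<alpha>] unfolding h_def by (rule integrable_pair_mult)
      show "(\<lambda>(t, \<xi>). (a - \<i> * of_real t) powr p * h \<xi> * E1 \<xi> * E2 t \<xi>) \<in> borel_measurable (lborel \<Otimes>\<^sub>M lborel)"
        unfolding E1_def E2_def p_def by measurable
      have "cmod (h \<xi> * E1 \<xi> * E2 t \<xi>) \<le> cmod (h \<xi>)" for t \<xi>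
      proof (cases "0 < \<xi>")
        case True
        have "cmod (E1 \<xi>) \<le> 1" using True s \<eta> by (simp add: E1_def)
        moreover have "cmod (E2 t \<xi>) = 1" by (simp add: E2_def)
        ultimately show ?thesis by (simp add: norm_mult mult_left_le)
      qed (simp add: h0)
      then show "AE x in lborel \<Otimes>\<^sub>M lborel. norm (case x of (t, \<xi>) \<Rightarrow> (a - \<i> * of_real t) powr p * h \<xi> * E1 \<xi> * E2 t \<xi>)
         \<le> norm (case x of (t, \<xi>) \<Rightarrow> (a - \<i> * of_real t) powr p * h \<xi>)"
        by (auto intro!: AE_I2 mult_left_mono simp: norm_mult mult.assoc)
    qed
  qed
  also have "\<dots> = (\<integral>\<xi>. C * of_real (\<eta> powr (- \<alpha> / 2)) * (of_real (psi_hat n \<alpha> \<xi> * \<xi> powr (\<alpha> / 2)) * exp (- ((q - 1) * of_real \<xi>))) \<partial>lborel)"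
  proof (rule Bochner_Integration.integral_cong)
    fix \<xi> :: real
    show "(\<integral>t. (a - \<i> * of_real t) powr p * h \<xi> * E1 \<xi> * E2 t \<xi> \<partial>lborel) =
      C * of_real (\<eta> powr (- \<alpha> / 2)) * (of_real (psi_hat n \<alpha> \<xi> * \<xi> powr (\<alpha> / 2)) * exp (- ((q - 1) * of_real \<xi>)))"
    proof (cases "0 < \<xi>")
      case True
      have "(\<integral>t. (a - \<i> * of_real t) powr p * h \<xi> * E1 \<xi> * E2 t \<xi> \<partial>lborel) =
         h \<xi> * E1 \<xi> * (\<integral>t. (a - \<i> * of_real t) powr p * E2 t \<xi> \<partial>lborel)"
        by (subst integral_mult_right_zero[symmetric]) (simp add: mult_ac)
      also have "(\<integral>t. (a - \<i> * of_real t) powr p * E2 t \<xi> \<partial>lborel) = C * of_real ((\<xi> / \<eta>) powr (\<alpha> / 2)) * exp (- (a * of_real (\<xi> / \<eta>)))"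
        unfolding p_def E2_def using True \<eta> a by (intro C) auto
      also have "(\<xi> / \<eta>) powr (\<alpha> / 2) = \<xi> powr (\<alpha> / 2) * \<eta> powr (- \<alpha> / 2)"
      proof -
        have "- \<alpha> / 2 = - (\<alpha> / 2)" by simp
        then show ?thesis by (simp only: powr_divide powr_minus divide_inverse[of "_ powr _"])
      qed
      also have "h \<xi> * E1 \<xi> * (C * of_real (\<xi> powr (\<alpha> / 2) * \<eta> powr (- \<alpha> / 2)) * exp (- (a * of_real (\<xi> / \<eta>)))) =
        C * of_real (\<eta> powr (- \<alpha> / 2)) * (of_real (psi_hat n \<alpha> \<xi> * \<xi> powr (\<alpha> / 2)) * (E1 \<xi> * exp (- (a * of_real (\<xi> / \<eta>)))))"
        by (simp add: h_def)
      also have "E1 \<xi> * exp (- (a * of_real (\<xi> / \<eta>))) = exp (- ((q - 1) * of_real \<xi>))"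
      proof -
        \<comment> \<open>The exponent is q - 1 rather than q because \<open>psi_hat\<close> carries
          a factor exp(-\<xi>) of its own.\<close>
        have "- ((of_real s - \<i> * of_real (Re z)) / of_real \<eta> * of_real \<xi>) + - (a * of_real (\<xi> / \<eta>)) = - ((q - 1) * of_real \<xi>)"
        proof -
          have "of_real s - \<i> * of_real (Re z) + a = 2 * of_real s - \<i> * (z - cnj w) - of_real \<eta>"
            by (simp add: a_def \<eta>_def complex_eq_iff)
          then have "q - 1 = (of_real s - \<i> * of_real (Re z) + a) / of_real \<eta>"
            using \<eta> by (simp only: q_def \<eta>_def diff_divide_distrib[of _ "of_real (Im z)"]) simp
          then show ?thesis by (simp add: add_divide_distrib distrib_right)
        qed
        then show ?thesis by (simp only: E1_def exp_add[symmetric])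
      qed
      finally show ?thesis .
    qed (simp add: h0 psi_hat_def)
  qed simp
  also have "\<dots> = C * of_real (\<eta> powr (- \<alpha> / 2)) * (of_real (psi_norm n \<alpha> * Gamma (real n + \<alpha> + 1) / fact n) * q powr (- of_real (\<alpha> + 1)) * (1 - 2 / q) ^ n)"
  proof -
    have "0 < Re q" using s w z by (simp add: q_def Re_divide_of_real)
    then show ?thesis by (simp only: integral_mult_right_zero laguerre_laplace[OF \<alpha>])
  qed
  finally show ?thesis
    by (simp add: K_def \<eta>_def)
qed

text \<open>Let s tend to 0 in \<open>wavelet_line_integral\<close>, so that q becomes -\<i> (z -
  \<open>cnj w\<close>) / Im z. Its modulus, with the powers of Im w and Im z, produces the defect,
  while |1 - 2/q| is \<rho>(z, w). All constants, including the unknown C, go into c.\<close>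

lemma wavelet_test_fn:
  assumes \<alpha>: "0 < \<alpha>"
  obtains c where "0 \<le> c" "\<And>w z. 0 < Im w \<Longrightarrow> 0 < Im z \<Longrightarrow>
    (cmod (wavelet_transform (psi n \<alpha>) (test_fn \<alpha> w) z))\<^sup>2 =
      c * (ph_defect z w powr (\<alpha> + 1) * cmod ((z - w) / (z - cnj w)) ^ (2 * n))"
proof -
  obtain C where C: "\<And>a \<xi>. 0 < Re a \<Longrightarrow> 0 < \<xi> \<Longrightarrow>
     (\<integral>t. (a - \<i> * of_real t) powr (- of_real (\<alpha> / 2 + 1)) * exp (- (\<i> * of_real t * of_real \<xi>)) \<partial>lborel)
       = C * of_real (\<xi> powr (\<alpha> / 2)) * exp (- (a * of_real \<xi>))"
    using fourier_powr[of "\<alpha> / 2 + 1"] \<alpha> by auto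
  define G where "G = psi_norm n \<alpha> * Gamma (real n + \<alpha> + 1) / fact n / (2 * pi)"
  have eq: "(cmod (wavelet_transform (psi n \<alpha>) (test_fn \<alpha> w) z))\<^sup>2 =
      (G * cmod C)\<^sup>2 / 4 powr (\<alpha> + 1) * (ph_defect z w powr (\<alpha> + 1) * cmod ((z - w) / (z - cnj w)) ^ (2 * n))"
    if w: "0 < Im w" and z: "0 < Im z" for w z
  proof -
    define M where "M = Im w powr ((\<alpha> + 1) / 2) * Im z powr (-1/2) * Im z powr (- \<alpha> / 2) / (2 * pi)
       * psi_norm n \<alpha> * Gamma (real n + \<alpha> + 1) / fact n"
    define q where "q s = (2 * of_real s - \<i> * (z - cnj w)) / complex_of_real (Im z)" for s
    define I where "I s = of_real M * C * q s powr (- of_real (\<alpha> + 1)) * (1 - 2 / q s) ^ n" for s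
    have q0: "0 < Re (q 0)" using w z by (simp add: q_def Re_divide_of_real divide_neg_pos)
    have "(I \<longlongrightarrow> I 0) (at_right 0)"
    proof -
      have "(q \<longlongrightarrow> q 0) (at_right 0)" unfolding q_def[abs_def] using z by (intro tendsto_intros) auto
      \<comment> \<open>Since Re (q 0) = (Im z + Im w) / Im z > 0, the limit point is off the branch
        cut.\<close>
      moreover have "q 0 \<notin> \<real>\<^sub>\<le>\<^sub>0" "q 0 \<noteq> 0" using q0 by (auto simp: complex_nonpos_Reals_iff)
      ultimately show ?thesis unfolding I_def[abs_def] by (intro tendsto_intros) auto
    qed
    moreover have "\<forall>\<^sub>F s in at_right 0. I s = (\<integral>t. test_fn \<alpha> w (of_real t + \<i> * of_real s) * cnj (time_scale_shift z (psi n \<alpha>) (of_real t + \<i> * of_real s)) \<partial>lborel)"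
      using eventually_at_right_less[of "0::real"]
    proof eventually_elim
      case (elim s)
      show ?case unfolding I_def M_def q_def by (rule wavelet_line_integral[OF \<alpha> w z elim C, symmetric])
    qed
    ultimately have "((\<lambda>s. \<integral>t. test_fn \<alpha> w (of_real t + \<i> * of_real s) * cnj (time_scale_shift z (psi n \<alpha>) (of_real t + \<i> * of_real s)) \<partial>lborel) \<longlongrightarrow> I 0) (at_right 0)"
      by (rule Lim_transform_eventually)
    then have W: "wavelet_transform (psi n \<alpha>) (test_fn \<alpha> w) z = I 0"
      unfolding wavelet_transform_def hardy2_inner_def by (intro tendsto_Lim) auto
    define D where "D = cmod (z - cnj w)"
    have nz: "z - cnj w \<noteq> 0" using w z by (auto simp: complex_eq_iff)
    then have D: "0 < D" by (simp add: D_def)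
    have nq: "cmod (q 0) = D / Im z" using z by (simp add: q_def norm_divide norm_mult D_def)
    have "1 - 2 / q 0 = (q 0 - 2) / q 0" using q0 by (auto simp: diff_divide_distrib)
    also have "q 0 - 2 = - (\<i> * (z - cnj w) + 2 * of_real (Im z)) / of_real (Im z)"
      using z by (simp add: q_def field_simps)
    \<comment> \<open>Adding 2 Im z inside turns z into \<open>cnj z\<close>, and the numerator
      becomes the conjugate of a difference.\<close>
    also have "\<i> * (z - cnj w) + 2 * of_real (Im z) = \<i> * cnj (w - z) * (-1)"
      by (simp add: complex_eq_iff)
    finally have "1 - 2 / q 0 = \<i> * cnj (w - z) / of_real (Im z) / q 0" by simp
    then have n2: "cmod (1 - 2 / q 0) = cmod ((z - w) / (z - cnj w))"
      using z nq D by (simp add: norm_divide norm_mult D_def norm_minus_commute del: complex_cnj_diff)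
    have "(cmod (I 0))\<^sup>2 = (M * cmod C * (D / Im z) powr (- (\<alpha> + 1)) * cmod ((z - w) / (z - cnj w)) ^ n)\<^sup>2"
    proof -
      have "cmod (q 0 powr (- of_real (\<alpha> + 1))) = cmod (q 0) powr (- (\<alpha> + 1))"
        by (subst norm_powr_real_powr') auto
      then show ?thesis
        by (simp only: I_def norm_mult norm_power n2 nq norm_of_real power_mult_distrib power2_abs)
    qed
    also have "\<dots> = (M * (D / Im z) powr (- (\<alpha> + 1)))\<^sup>2 * (cmod C)\<^sup>2 * cmod ((z - w) / (z - cnj w)) ^ (2 * n)"
      by (simp add: power_mult_distrib power_even_eq mult_ac flip: power_mult)
    also have "(M * (D / Im z) powr (- (\<alpha> + 1)))\<^sup>2 = G\<^sup>2 * (ph_defect z w powr (\<alpha> + 1) / 4 powr (\<alpha> + 1))"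
    proof -
      have sq: "(x powr y)\<^sup>2 = x powr (2 * y)" for x y :: real
        by (simp add: power2_eq_square flip: powr_add)
      have "(M * (D / Im z) powr (- (\<alpha> + 1)))\<^sup>2 = G\<^sup>2 * ((Im w powr ((\<alpha> + 1) / 2))\<^sup>2 * (Im z powr (-1/2))\<^sup>2 * (Im z powr (- \<alpha> / 2))\<^sup>2 * ((D / Im z) powr (- (\<alpha> + 1)))\<^sup>2)"
      proof -
        have "(a1 * a2 * a3 / c * N * Gm / f * X)\<^sup>2 = (N * Gm / f / c)\<^sup>2 * (a1\<^sup>2 * a2\<^sup>2 * a3\<^sup>2 * X\<^sup>2)"
          for a1 a2 a3 c N Gm f X :: real
          by (simp add: power_mult_distrib power_divide mult_ac)
        then show ?thesis unfolding M_def G_def .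
      qed
      also have "(Im w powr ((\<alpha> + 1) / 2))\<^sup>2 * (Im z powr (-1/2))\<^sup>2 * (Im z powr (- \<alpha> / 2))\<^sup>2 * ((D / Im z) powr (- (\<alpha> + 1)))\<^sup>2
         = Im w powr (\<alpha> + 1) * (Im z powr (-1) * Im z powr (- \<alpha>)) * (D / Im z) powr (- (\<alpha> + 1) + - (\<alpha> + 1))"
      proof -
        have "2 * ((\<alpha> + 1) / 2) = \<alpha> + 1" "2 * (-1/2 :: real) = -1" "2 * (- \<alpha> / 2) = - \<alpha>" "2 * - (\<alpha> + 1) = - (\<alpha> + 1) + - (\<alpha> + 1)"
          by simp_all
        then show ?thesis unfolding sq by (simp only: mult.assoc)
      qed
      also have "\<dots> = (Im w * Im z / (D * D)) powr (\<alpha> + 1)"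
      proof -
        define X Y Z where "X = Im w powr (\<alpha> + 1)" and "Y = Im z powr (\<alpha> + 1)" and "Z = D powr (\<alpha> + 1)"
        have pos: "0 < Y" "0 < Z" using z D by (simp_all add: Y_def Z_def)
        have "Im z powr (-1) * Im z powr (- \<alpha>) = Im z powr (- (\<alpha> + 1))"
          unfolding powr_add[symmetric] by (rule arg_cong[where f = "(powr) (Im z)"]) simp
        also have "\<dots> = inverse Y" unfolding Y_def by (rule powr_minus)
        finally have 1: "Im z powr (-1) * Im z powr (- \<alpha>) = inverse Y" .
        have 2: "(D / Im z) powr (- (\<alpha> + 1)) = inverse (Z / Y)"
          unfolding powr_minus powr_divide Y_def Z_def ..
        have 3: "(Im w * Im z / (D * D)) powr (\<alpha> + 1) = X * Y / (Z * Z)"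
          using w z D by (simp only: powr_divide powr_mult X_def Y_def Z_def)
        show ?thesis
          unfolding 1 2 3 powr_add[of "D / Im z"] X_def[symmetric] using pos by (simp add: field_simps)
      qed
      also have "Im w * Im z / (D * D) = ph_defect z w / 4"
        by (simp add: ph_defect_def D_def power2_eq_square)
      also have "(ph_defect z w / 4) powr (\<alpha> + 1) = ph_defect z w powr (\<alpha> + 1) / 4 powr (\<alpha> + 1)"
        by (rule powr_divide)
      finally show ?thesis .
    qed
    finally show ?thesis unfolding W by (simp add: power_mult_distrib)
  qed
  show thesis by (rule that[OF _ eq]) auto
qed

section \<open>The density bound\<close>

text \<open>The circle radius r and the separation d stay free here, because the cases n = 0 and n >
  0 choose them differently. The condition on d says that points outside the disk have distance at
  least d from the circle of radius r.\<close>

lemma sampling_disk_bound: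
  fixes \<mu> :: "complex measure"
  assumes \<alpha>: "0 < \<alpha>" and sets: "sets \<mu> = sets (restrict_space borel upper_half)"
    and A: "0 < A" and B: "0 < B"
    and sampling: "\<And>f. hardy2 f \<Longrightarrow>
           ennreal (A * hardy2_norm_sq f)
             \<le> (\<integral>\<^sup>+ w. ennreal ((cmod (wavelet_transform (psi n \<alpha>) f w))\<^sup>2) \<partial>\<mu>)
         \<and> (\<integral>\<^sup>+ w. ennreal ((cmod (wavelet_transform (psi n \<alpha>) f w))\<^sup>2) \<partial>\<mu>)
             \<le> ennreal (B * hardy2_norm_sq f)"
    and z: "z \<in> upper_half" and null: "emeasure \<mu> (ph_disk R z) = 0"
    and r: "0 \<le> r" "r \<le> R" "r < 1"
    and d: "0 \<le> d" "\<And>s. R \<le> s \<Longrightarrow> s < 1 \<Longrightarrow> d * (1 - r * s) \<le> s - r"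
  shows "d ^ (2 * n) * A \<le> 2 * (pi + 1) * (2 * (1 - r\<^sup>2)) powr \<alpha> * B"
proof -
  define k where "k u w = ph_defect u w powr (\<alpha> + 1) * cmod ((u - w) / (u - cnj w)) ^ (2 * n)" for u w
  define L where "L = line_norm \<alpha>"
  have L: "0 < L" unfolding L_def by (rule line_norm(2)[OF \<alpha>])
  obtain c where c: "0 \<le> c" "\<And>w u. 0 < Im w \<Longrightarrow> 0 < Im u \<Longrightarrow> (cmod (wavelet_transform (psi n \<alpha>) (test_fn \<alpha> w) u))\<^sup>2 = c * k u w"
    using wavelet_test_fn[OF \<alpha>] unfolding k_def by blast
  have sp: "space \<mu> = upper_half"
    using sets_eq_imp_space_eq[OF sets] by (simp add: space_restrict_space)
  have bounds: "ennreal (A * L) \<le> (\<integral>\<^sup>+ u. ennreal (c * k u w) \<partial>\<mu>)" "(\<integral>\<^sup>+ u. ennreal (c * k u w) \<partial>\<mu>) \<le> ennreal (B * L)"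
    if w: "0 < Im w" for w
  proof -
    have "(\<integral>\<^sup>+ u. ennreal ((cmod (wavelet_transform (psi n \<alpha>) (test_fn \<alpha> w) u))\<^sup>2) \<partial>\<mu>) = (\<integral>\<^sup>+ u. ennreal (c * k u w) \<partial>\<mu>)"
      by (intro nn_integral_cong) (simp add: c(2)[OF w] sp upper_half_def)
    then show "ennreal (A * L) \<le> (\<integral>\<^sup>+ u. ennreal (c * k u w) \<partial>\<mu>)" "(\<integral>\<^sup>+ u. ennreal (c * k u w) \<partial>\<mu>) \<le> ennreal (B * L)"
      using sampling[OF hardy2_test_fn(1)[OF \<alpha> w]] hardy2_test_fn(2)[OF \<alpha> w] by (simp_all add: L_def)
  qed
  have meas: "(\<lambda>u. ennreal (c * k u w)) \<in> borel_measurable \<mu>" for w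
  proof -
    have "(\<lambda>u. ennreal (c * k u w)) \<in> borel_measurable borel"
      unfolding k_def ph_defect_def by measurable
    then show ?thesis
      by (simp add: measurable_cong_sets[OF sets refl] measurable_restrict_space1)
  qed
  have z0: "0 < Im z" using z by (simp add: upper_half_def)
  \<comment> \<open>The least number of points for which half an arc, \<pi> / N, is at most 1 -
    r^2.\<close>
  define N where "N = nat \<lceil>pi / (1 - r\<^sup>2)\<rceil>"
  define M where "M = (2 * (1 - r\<^sup>2)) powr (\<alpha> + 1)"
  have r2: "0 < 1 - r\<^sup>2" using r by (simp add: abs_square_less_1)
  have N: "pi / (1 - r\<^sup>2) \<le> real N" "real N \<le> pi / (1 - r\<^sup>2) + 1"
    using r2 pi_gt_zero unfolding N_def by (auto simp: of_nat_nat intro!: real_nat_ceiling_ge)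
  define p where "p = circle_pt z r N"
  have p: "0 < Im (p j)" for j unfolding p_def using z0 r by (intro circle_pt) auto
  have k0: "0 \<le> k u w" for u w by (simp add: k_def)
  have cover: "d ^ (2 * n) * k u z \<le> (\<Sum>j<N. M * k u (p j))" if u: "0 < Im u" "u \<notin> ph_disk R z" for u
  proof -
    have eq: "cmod ((u - z) / (u - cnj z)) = cmod ((z - u) / (z - cnj u))"
    proof -
      have "cmod (u - cnj z) = cmod (z - cnj u)"
        by (metis complex_cnj_cnj complex_cnj_diff complex_mod_cnj norm_minus_commute)
      then show ?thesis by (simp add: norm_divide norm_minus_commute)
    qed
    have R: "R \<le> cmod ((u - z) / (u - cnj z))" unfolding eq
      using u by (simp add: ph_disk_def upper_half_def)
    obtain j where j: "j < N" "ph_defect u z \<le> 2 * (1 - r\<^sup>2) * ph_defect u (p j)" "d \<le> cmod ((u - p j) / (u - cnj (p j)))"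
      unfolding p_def
    proof (rule circle_pt_covers[OF u(1) z0 r(1,3) N(1)])
      show "r \<le> cmod ((u - z) / (u - cnj z))" using R r(2) by linarith
      show "d * (1 - r * s) \<le> s - r" if "s < 1" "cmod ((u - z) / (u - cnj z)) \<le> s" for s
        using that R by (intro d) auto
    qed (use d in auto)
    have "cmod ((u - z) / (u - cnj z)) \<le> 1"
    proof -
      have "(cmod ((u - z) / (u - cnj z)))\<^sup>2 \<le> 1"
        using ph_defect_eq[OF u(1) z0] ph_defect_pos[OF u(1) z0] by linarith
      then show ?thesis by (simp add: abs_square_le_1)
    qed
    \<comment> \<open>The factor \<rho>^(2n) of \<open>k u z\<close> is bounded by 1; the one of
      \<open>k u (p j)\<close> has to be bounded below, which costs d^(2n).\<close>
    then have "k u z \<le> ph_defect u z powr (\<alpha> + 1)"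
      unfolding k_def by (intro mult_right_le_one_le power_le_one) auto
    also have "\<dots> \<le> (2 * (1 - r\<^sup>2) * ph_defect u (p j)) powr (\<alpha> + 1)"
      using j(2) ph_defect_pos[OF u(1) z0] \<alpha> by (intro powr_mono2) auto
    also have "\<dots> = M * ph_defect u (p j) powr (\<alpha> + 1)"
      by (simp only: M_def powr_mult)
    finally have "d ^ (2 * n) * k u z \<le> cmod ((u - p j) / (u - cnj (p j))) ^ (2 * n) * (M * ph_defect u (p j) powr (\<alpha> + 1))"
      using j(3) d k0 by (intro mult_mono power_mono) auto
    also have "\<dots> = M * k u (p j)" by (simp add: k_def)
    also have "\<dots> \<le> (\<Sum>j<N. M * k u (p j))"
      using j(1) k0 by (intro member_le_sum) (auto simp: M_def)
    finally show ?thesis .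
  qed
  \<comment> \<open>\<open>emeasure\<close> is 0 on non-measurable sets too, so a null set requires
    the disk to be measurable.\<close>
  have disk: "ph_disk R z \<in> null_sets \<mu>"
  proof -
    have "ph_disk R z = upper_half \<inter> {w. cmod ((z - w) / (z - cnj w)) < R}"
      by (auto simp: ph_disk_def)
    moreover have "{w. cmod ((z - w) / (z - cnj w)) < R} \<in> sets borel"
    proof -
      have [measurable]: "cnj \<in> borel_measurable borel"
        by (intro borel_measurable_continuous_onI continuous_intros)
      show ?thesis by measurable
    qed
    ultimately have "ph_disk R z \<in> sets (restrict_space borel upper_half)"
      by (auto simp: sets_restrict_space)
    then show ?thesis using sets null by auto
  qed
  have "ennreal (d ^ (2 * n) * (A * L)) = ennreal (d ^ (2 * n)) * ennreal (A * L)"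
    using d by (intro ennreal_mult) (use A L in auto)
  also have "\<dots> \<le> ennreal (d ^ (2 * n)) * (\<integral>\<^sup>+ u. ennreal (c * k u z) \<partial>\<mu>)"
    using bounds(1)[OF z0] by (rule mult_left_mono) simp
  also have "\<dots> = (\<integral>\<^sup>+ u. ennreal (d ^ (2 * n)) * ennreal (c * k u z) \<partial>\<mu>)"
    by (rule nn_integral_cmult[symmetric, OF meas])
  also have "\<dots> \<le> (\<integral>\<^sup>+ u. (\<Sum>j<N. ennreal M * ennreal (c * k u (p j))) \<partial>\<mu>)"
  proof (rule nn_integral_mono_AE)
    show "AE u in \<mu>. ennreal (d ^ (2 * n)) * ennreal (c * k u z) \<le> (\<Sum>j<N. ennreal M * ennreal (c * k u (p j)))"
      using AE_not_in[OF disk] AE_space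
    proof eventually_elim
      case (elim u)
      then have "c * (d ^ (2 * n) * k u z) \<le> c * (\<Sum>j<N. M * k u (p j))"
        by (intro mult_left_mono cover c(1)) (auto simp: sp upper_half_def)
      then have "ennreal (d ^ (2 * n) * (c * k u z)) \<le> ennreal (\<Sum>j<N. M * (c * k u (p j)))"
        by (intro ennreal_leI) (simp add: sum_distrib_left mult_ac)
      also have "\<dots> = (\<Sum>j<N. ennreal M * ennreal (c * k u (p j)))"
        using c(1) k0 by (subst sum_ennreal[symmetric]) (auto simp: M_def ennreal_mult)
      finally show ?case using d c(1) k0 by (simp add: ennreal_mult)
    qed
  qed
  also have "\<dots> = (\<Sum>j<N. ennreal M * (\<integral>\<^sup>+ u. ennreal (c * k u (p j)) \<partial>\<mu>))"
    by (subst nn_integral_sum) (auto intro!: sum.cong nn_integral_cmult borel_measurable_times_ennreal meas)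
  also have "\<dots> \<le> (\<Sum>j<N. ennreal M * ennreal (B * L))"
    by (intro sum_mono mult_left_mono bounds p) auto
  also have "\<dots> = ennreal (real N * (M * (B * L)))"
    using B L by (simp add: M_def ennreal_mult ennreal_of_nat_eq_real_of_nat)
  finally have "d ^ (2 * n) * (A * L) \<le> real N * (M * (B * L))"
    using B L by (subst (asm) ennreal_le_iff) (auto simp: M_def)
  then have "(d ^ (2 * n) * A) * L \<le> (real N * M * B) * L" by (simp add: mult.assoc)
  then have "d ^ (2 * n) * A \<le> real N * M * B" using L by simp
  also have "\<dots> \<le> 2 * (pi + 1) * (2 * (1 - r\<^sup>2)) powr \<alpha> * B"
  proof (intro mult_right_mono)
    \<comment> \<open>One of the \<alpha> + 1 powers of 1 - r^2 is split off to pay for the number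
      of points: N (1 - r^2) \<le> \<pi> + 1. This leaves the exponent \<alpha>.\<close>
    have M: "M = 2 * (1 - r\<^sup>2) * (2 * (1 - r\<^sup>2)) powr \<alpha>"
      using r2 by (simp add: M_def powr_add)
    have "real N * (1 - r\<^sup>2) \<le> (pi / (1 - r\<^sup>2) + 1) * (1 - r\<^sup>2)"
      using N(2) r2 by (intro mult_right_mono) auto
    also have "\<dots> = pi + (1 - r\<^sup>2)" using r2 by (simp add: distrib_right)
    also have "\<dots> \<le> pi + 1" by simp
    finally have "2 * (real N * (1 - r\<^sup>2)) * (2 * (1 - r\<^sup>2)) powr \<alpha> \<le> 2 * (pi + 1) * (2 * (1 - r\<^sup>2)) powr \<alpha>"
      by (intro mult_right_mono) auto
    then show "real N * M \<le> 2 * (pi + 1) * (2 * (1 - r\<^sup>2)) powr \<alpha>"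
      unfolding M by (simp add: mult_ac)
  qed (use B in auto)
  finally show ?thesis .
qed

theorem theorem1:
  fixes n :: nat and \<alpha> A B R :: real and \<mu> :: "complex measure" and z :: complex
  assumes "0 < \<alpha>"
    and "sets \<mu> = sets (restrict_space borel upper_half)"
    and "0 < A" and "0 < B"
    and "\<And>f. hardy2 f \<Longrightarrow>
           ennreal (A * hardy2_norm_sq f)
             \<le> (\<integral>\<^sup>+ w. ennreal ((cmod (wavelet_transform (psi n \<alpha>) f w))\<^sup>2) \<partial>\<mu>)
         \<and> (\<integral>\<^sup>+ w. ennreal ((cmod (wavelet_transform (psi n \<alpha>) f w))\<^sup>2) \<partial>\<mu>)
             \<le> ennreal (B * hardy2_norm_sq f)"
    and "0 < R" and "R < 1"
    and "z \<in> upper_half"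
    and "emeasure \<mu> (ph_disk R z) = 0"
  shows "R \<le> 1 - (C_const n \<alpha> / pi * (A / B)) powr (1 / \<alpha>)"
proof -
  have bound: "d ^ (2 * n) * A \<le> 2 * (pi + 1) * (2 * (1 - r\<^sup>2)) powr \<alpha> * B"
    if "0 \<le> r" "r \<le> R" "r < 1" "0 \<le> d" "\<And>s. R \<le> s \<Longrightarrow> s < 1 \<Longrightarrow> d * (1 - r * s) \<le> s - r" for r d
    by (rule sampling_disk_bound[OF assms(1-4) _ assms(8,9) that]) (rule assms(5))
  have conv: "C / pi * (A / B) \<le> Q" if "A \<le> P * pi * Q * B" "C = 1 / P" "0 < P" for C P Q
  proof -
    have "C / pi * (A / B) = A / (P * pi * B)" using that(2) by simp
    also have "\<dots> \<le> Q" using that assms(4) by (simp add: pos_divide_le_eq mult_ac)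
    finally show ?thesis .
  qed
  have "C_const n \<alpha> / pi * (A / B) \<le> (1 - R) powr \<alpha>"
  proof (cases "n = 0")
    case True
    \<comment> \<open>With r = R no separation is available, so d = 0; since n = 0 the factor is 0^0
      = 1.\<close>
    have "0 ^ (2 * n) * A \<le> 2 * (pi + 1) * (2 * (1 - R\<^sup>2)) powr \<alpha> * B"
      using assms(6,7) by (intro bound) auto
    also have "\<dots> \<le> 2 * (pi + 1) * (4 * (1 - R)) powr \<alpha> * B"
    proof -
      have "2 * (1 - R\<^sup>2) \<le> 4 * (1 - R)"
        using assms(6,7) zero_le_power2[of "1 - R"] by (simp add: power2_eq_square algebra_simps)
      moreover have "0 \<le> 1 - R\<^sup>2" using assms(6,7) by (simp add: abs_square_le_1)
      ultimately show ?thesis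
        using assms(1,4) by (intro mult_right_mono mult_left_mono powr_mono2) auto
    qed
    also have "\<dots> \<le> 4 * pi * (4 * (1 - R)) powr \<alpha> * B"
      using assms(4) pi_ge_two by (intro mult_right_mono) auto
    also have "(4 * (1 - R)) powr \<alpha> = 4 powr \<alpha> * (1 - R) powr \<alpha>"
      by (rule powr_mult)
    finally have "A \<le> 4 powr (\<alpha> + 1) * pi * (1 - R) powr \<alpha> * B"
      using True by (simp add: powr_add mult_ac)
    moreover have "C_const n \<alpha> = 1 / 4 powr (\<alpha> + 1)"
      unfolding C_const_def powr_minus_divide using True by simp
    ultimately show ?thesis by (rule conv) simp
  next
    case False
    have main: "A \<le> 6 powr (2 * real n + \<alpha> + 1) * pi * (1 - R) powr \<alpha> * B"
    \<comment> \<open>The threshold is where 1 - 7/5 (1 - R) becomes nonnegative, that is, where it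
      can serve as a radius.\<close>
    proof (cases "1 - R \<le> 5 / 7")
      case True
      \<comment> \<open>\<open>1 - r = 7/5 (1 - R)\<close> puts the circle at pseudohyperbolic distance at least \<open>1/6\<close> from the
        complement of the disk, while \<open>4 (1 - r) \<le> 6 (1 - R)\<close>.\<close>
      define r where "r = (7 * R - 2) / 5"
      have r: "0 \<le> r" "r \<le> R" "r < 1" using True assms(7) by (simp_all add: r_def)
      have "(1 / 6) ^ (2 * n) * A \<le> 2 * (pi + 1) * (2 * (1 - r\<^sup>2)) powr \<alpha> * B"
      proof (rule bound[OF r])
        fix s assume s: "R \<le> s" "s < 1"
        \<comment> \<open>The worst case is s = R, where 6 (R - r) - (1 - r R) = 7/5 (1 - R)^2. The
          distance (R - r) / (1 - r R) = 2 / (7 R + 5) tends to 1/6 as R tends to 1.\<close>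
        have "(1 - R) * (1 - R) \<ge> 0" by simp
        have "1 - r * s \<le> 1 - r * R" using s r by (simp add: mult_left_mono)
        also have "\<dots> \<le> 6 * (R - r)"
          using \<open>0 \<le> (1 - R) * (1 - R)\<close> by (simp add: r_def field_simps)
        also have "\<dots> \<le> 6 * (s - r)" using s by simp
        finally show "1 / 6 * (1 - r * s) \<le> s - r" by simp
      qed simp
      also have "\<dots> \<le> 6 * pi * (6 * (1 - R)) powr \<alpha> * B"
      proof -
        have "2 * (1 - r\<^sup>2) \<le> 4 * (1 - r)"
          using zero_le_power2[of "1 - r"] by (simp add: power2_eq_square algebra_simps)
        also have "\<dots> \<le> 6 * (1 - R)" using assms(7) by (simp add: r_def field_simps)
        finally have pw: "(2 * (1 - r\<^sup>2)) powr \<alpha> \<le> (6 * (1 - R)) powr \<alpha>"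
          using assms(1) r by (intro powr_mono2) (auto simp: abs_square_le_1)
        have pi6: "2 * (pi + 1) \<le> 6 * pi" using pi_ge_two by simp
        have "2 * (pi + 1) * (2 * (1 - r\<^sup>2)) powr \<alpha> \<le> 6 * pi * (6 * (1 - R)) powr \<alpha>"
          by (rule mult_mono[OF pi6 pw]) auto
        then show ?thesis by (rule mult_right_mono) (use assms(4) in simp)
      qed
      also have "(6 * (1 - R)) powr \<alpha> = 6 powr \<alpha> * (1 - R) powr \<alpha>" by (rule powr_mult)
      finally have "A \<le> 6 ^ (2 * n) * (6 * pi * (6 powr \<alpha> * (1 - R) powr \<alpha>) * B)"
        by (simp add: power_one_over field_simps)
      also have "\<dots> = 6 powr (2 * real n + \<alpha> + 1) * pi * (1 - R) powr \<alpha> * B"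
        using powr_realpow[of 6 "2 * n"] by (simp add: powr_add)
      finally show ?thesis .
    next
      case False
      \<comment> \<open>For small R the disk is irrelevant: 6 (1 - R) > 1 makes the right-hand
        factor at least 1, and one nonzero test function, here at \<i>, gives A \<le> B.\<close>
      have L: "0 < line_norm \<alpha>" by (rule line_norm(2)[OF assms(1)])
      have "ennreal (A * line_norm \<alpha>) \<le> ennreal (B * line_norm \<alpha>)"
        using assms(5)[OF hardy2_test_fn(1)[OF assms(1), of \<i>]] hardy2_test_fn(2)[OF assms(1), of \<i>]
        by (auto intro: order.trans)
      then have "A \<le> B" using L assms(4) by (simp add: ennreal_le_iff)
      have "1 \<le> 6 powr \<alpha> * (1 - R) powr \<alpha>"
        unfolding powr_mult[symmetric] using False assms(1) by (intro ge_one_powr_ge_zero) auto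
      moreover have "1 \<le> 6 powr (2 * real n + 1) * pi"
        using pi_ge_two by (intro mult_ge1_I ge_one_powr_ge_zero) auto
      ultimately have "1 \<le> 6 powr (2 * real n + 1) * pi * (6 powr \<alpha> * (1 - R) powr \<alpha>)"
        by (intro mult_ge1_I[of "_ * pi"])
      also have "\<dots> = 6 powr (2 * real n + \<alpha> + 1) * pi * (1 - R) powr \<alpha>"
        by (simp add: powr_add)
      finally have "1 * B \<le> 6 powr (2 * real n + \<alpha> + 1) * pi * (1 - R) powr \<alpha> * B"
        using assms(4) by (intro mult_right_mono) auto
      then show ?thesis using \<open>A \<le> B\<close> by simp
    qed
    moreover have "C_const n \<alpha> = 1 / 6 powr (2 * real n + \<alpha> + 1)"
      unfolding C_const_def powr_minus_divide using False by simp
    ultimately show ?thesis by (rule conv) simp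
  qed
  moreover have "0 \<le> C_const n \<alpha> / pi * (A / B)"
    using assms(3,4) by (simp add: C_const_def)
  ultimately have "(C_const n \<alpha> / pi * (A / B)) powr (1 / \<alpha>) \<le> ((1 - R) powr \<alpha>) powr (1 / \<alpha>)"
    using assms(1) by (intro powr_mono2) auto
  also have "\<dots> = 1 - R"
    using assms(1,7) by (simp add: powr_powr)
  finally show ?thesis by simp
qed

end
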